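(* Let $s=(s(1),\dots,s(n))$ be a weak composition and $\overleftarrow{s}=(s(n),\dots,s(1))$. The map $\varphi$ is an isomorphism between the $s$-Tamari lattice and the $\nu(\overleftarrow{s})$-Tamari lattice.
   Context: A weak composition is a finite sequence $s=(s(1),\dots,s(n))$ of nonnegative integers. An $s$-decreasing tree is a rooted planar tree with exactly $n$ internal nodes, labelled bijectively by $1,\dots,n$ (an internal node is identified with its label; the other nodes are unlabelled leaves), such that internal node $i$ has exactly $s(i)+1$ ordered children and all internal nodes that are descendants of $i$ have labels smaller than $i$. For a node $y$ of $T$, $T^y_0,\dots,T^y_{s(y)}$ denote its child subtrees from left to right, and $x\in T^y_i$ means that internal node $x$ lies in that subtree. If $x<y$ and $x$ is not a descendant of $y$, let $z$ be the first (closest) common ancestor of $x$ and $y$, with $x\in T^z_j$, $y\in T^z_i$, $i\neq j$; $x$ is left of $y$ if $j<i$ and right of $y$ if $j>i$. For $x<y$ the cardinality $\#_T(y,x)$ is: $0$ if $x$ is left of $y$; $i$ if $x\in T^y_i$; $s(y)$ if $x$ is right of $y$. The $s$-weak order is defined by $R\preccurlyeq T$ iff $\#_R(y,x)\le \#_T(y,x)$ for all $x<y$. An $s$-decreasing tree $T$ is an $s$-Tamari tree if $\#_T(c,a)\le\#_T(c,b)$ for all $a<b<c$. The $s$-Tamari lattice is the restriction of the $s$-weak order to the set of $s$-Tamari trees. Lattice paths consist of unit north steps $N$ and unit east steps $E$. For a weak composition $t=(t(1),\dots,t(n))$, $\nu(t)=NE^{t(1)}NE^{t(2)}\cdots NE^{t(n)}$;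 thus $\nu(\overleftarrow s)=NE^{s(n)}\cdots NE^{s(1)}$. Given a lattice path $\nu$, a $\nu$-path is a lattice path with north and east steps having the same endpoints as $\nu$ and lying weakly above $\nu$. For a lattice point $p$ on a $\nu$-path $\mu$, $\operatorname{horiz}_\nu(p)$ is the maximum number of east steps that can be added to the right of $p$ without crossing $\nu$. A valley of $\mu$ is a lattice point of $\mu$ preceded by an $E$ and followed by an $N$. Given a valley $p$ of $\mu$, let $q$ be the next lattice point of $\mu$ after $p$ with $\operatorname{horiz}_\nu(q)=\operatorname{horiz}_\nu(p)$, let $\mu_{[p,q]}$ be the subpath of $\mu$ from $p$ to $q$, and let $\mu'$ be obtained from $\mu$ by switching the $E$ preceding $p$ with $\mu_{[p,q]}$; $\mu'$ is the $\nu$-rotation of $\mu$ at $p$. The $\nu$-Tamari lattice is the poset on $\nu$-paths whose cover relations are $\mu\lessdot\mu'$ for $\mu'$ a $\nu$-rotation of $\mu$ (it is a lattice). The reversed preorder traversal of a tree visits the root $r$ first and then visits, each in reversed preorder, the subtrees $T^r_{i}$ in decreasing order of $i$ (right to left); both internal nodes and leaves are visited. For an $s$-Tamari tree $T$, $\varphi(T)$ is the lattice path obtained by labelling the internal nodes of $T$ by $N$ and the leaves by $E$, reading these labels in reversed preorder, and omitting the last $E$. *)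

theory Defs
  imports Main
begin

section \<open>Decreasing trees\<close>

text \<open>
  A weak composition of length n is a \<open>nat list\<close> of length n. Its entries are
  indexed from 1, as in the mathematical notation s(1), ..., s(n).
\<close>

definition part :: "nat list \<Rightarrow> nat \<Rightarrow> nat" where
  "part s i = s ! (i - 1)"

datatype tree = Leaf | Node nat "tree list"

fun labels :: "tree \<Rightarrow> nat list" where
  "labels Leaf = []"
| "labels (Node i ts) = i # concat (map labels ts)"

fun subtrees :: "tree \<Rightarrow> tree set" where
  "subtrees Leaf = {Leaf}"
| "subtrees (Node i ts) = insert (Node i ts) (\<Union>t \<in> set ts. subtrees t)"

definition s_decreasing_tree :: "nat list \<Rightarrow> tree \<Rightarrow> bool" where
  "s_decreasing_tree s T \<longleftrightarrow>
     distinct (labels T) \<and> set (labels T) = {1..length s} \<and>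
     (\<forall>i ts. Node i ts \<in> subtrees T \<longrightarrow>
        length ts = part s i + 1 \<and>
        (\<forall>t \<in> set ts. \<forall>x \<in> set (labels t). x < i))"

text \<open>
  \<open>in_child T y i x\<close> is the statement that the internal node x lies in the child
  subtree number i (counted from 0, left to right) of the internal node y of T.
\<close>

definition in_child :: "tree \<Rightarrow> nat \<Rightarrow> nat \<Rightarrow> nat \<Rightarrow> bool" where
  "in_child T y i x \<longleftrightarrow>
     (\<exists>ts. Node y ts \<in> subtrees T \<and> i < length ts \<and> x \<in> set (labels (ts ! i)))"

definition descendant :: "tree \<Rightarrow> nat \<Rightarrow> nat \<Rightarrow> bool" where
  "descendant T x y \<longleftrightarrow> (\<exists>i. in_child T y i x)"

definition common_ancestor :: "tree \<Rightarrow> nat \<Rightarrow> nat \<Rightarrow> nat \<Rightarrow> bool" where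
  "common_ancestor T z x y \<longleftrightarrow> descendant T x z \<and> descendant T y z"

definition closest_common_ancestor :: "tree \<Rightarrow> nat \<Rightarrow> nat \<Rightarrow> nat \<Rightarrow> bool" where
  "closest_common_ancestor T z x y \<longleftrightarrow>
     common_ancestor T z x y \<and>
     \<not> (\<exists>w. common_ancestor T w x y \<and> descendant T w z)"

definition left_of :: "tree \<Rightarrow> nat \<Rightarrow> nat \<Rightarrow> bool" where
  "left_of T x y \<longleftrightarrow> \<not> descendant T x y \<and>
     (\<exists>z i j. closest_common_ancestor T z x y \<and> in_child T z j x \<and> in_child T z i y \<and> j < i)"

definition right_of :: "tree \<Rightarrow> nat \<Rightarrow> nat \<Rightarrow> bool" where
  "right_of T x y \<longleftrightarrow> \<not> descendant T x y \<and>
     (\<exists>z i j. closest_common_ancestor T z x y \<and> in_child T z j x \<and> in_child T z i y \<and> j > i)"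

text \<open>
  The cardinality of (y, x). It is meaningful for internal nodes x < y of an
  s-decreasing tree; then exactly one of the three conditions holds, and the child
  index i is unique.
\<close>

definition inv_card :: "nat list \<Rightarrow> tree \<Rightarrow> nat \<Rightarrow> nat \<Rightarrow> nat" where
  "inv_card s T y x =
     (if left_of T x y then 0
      else if descendant T x y then (THE i. in_child T y i x)
      else if right_of T x y then part s y
      else undefined)"

definition s_weak_le :: "nat list \<Rightarrow> tree \<Rightarrow> tree \<Rightarrow> bool" where
  "s_weak_le s R T \<longleftrightarrow>
     (\<forall>x y. 1 \<le> x \<and> x < y \<and> y \<le> length s \<longrightarrow> inv_card s R y x \<le> inv_card s T y x)"

definition s_Tamari_trees :: "nat list \<Rightarrow> tree set" where
  "s_Tamari_trees s =
     {T. s_decreasing_tree s T \<and>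
         (\<forall>a b c. 1 \<le> a \<and> a < b \<and> b < c \<and> c \<le> length s \<longrightarrow>
            inv_card s T c a \<le> inv_card s T c b)}"

section \<open>Lattice paths\<close>

datatype step = North | East

text \<open>
  A lattice path is the list of its steps; all paths start at the origin, so two
  paths have the same endpoints iff they have the same final point. The lattice
  points of \<open>\<mu>\<close> are \<open>point \<mu> k\<close> for \<open>k \<le> length \<mu>\<close>.
\<close>

type_synonym path = "step list"

definition point :: "path \<Rightarrow> nat \<Rightarrow> nat \<times> nat" where
  "point \<mu> k = (count_list (take k \<mu>) East, count_list (take k \<mu>) North)"

definition points :: "path \<Rightarrow> (nat \<times> nat) set" where
  "points \<mu> = point \<mu> ` {..length \<mu>}"

definition nu :: "nat list \<Rightarrow> path" where
  "nu t = concat (map (\<lambda>k. North # replicate k East) t)"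

text \<open>
  A point is weakly above \<open>\<nu>\<close> if some point of \<open>\<nu>\<close> lies at or below it in the same
  column. Requiring this of lattice points only is enough: an east step whose right
  end satisfies it does not cross \<open>\<nu>\<close>. There are no such points right of the end
  of \<open>\<nu>\<close>, so the maximum in \<open>horiz\<close> is over a finite set.
\<close>

definition point_weakly_above :: "path \<Rightarrow> nat \<times> nat \<Rightarrow> bool" where
  "point_weakly_above \<nu> p \<longleftrightarrow> (\<exists>y \<le> snd p. (fst p, y) \<in> points \<nu>)"

definition nu_paths :: "path \<Rightarrow> path set" where
  "nu_paths \<nu> =
     {\<mu>. point \<mu> (length \<mu>) = point \<nu> (length \<nu>) \<and>
         (\<forall>p \<in> points \<mu>. point_weakly_above \<nu> p)}"

definition horiz :: "path \<Rightarrow> nat \<times> nat \<Rightarrow> nat" where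
  "horiz \<nu> p = Max {h. \<forall>j \<le> h. point_weakly_above \<nu> (fst p + j, snd p)}"

text \<open>
  Valleys and rotations refer to a lattice point of \<open>\<mu>\<close> by its position k; the step
  before it is \<open>\<mu> ! (k - 1)\<close> and the step after it is \<open>\<mu> ! k\<close>.
\<close>

definition valley :: "path \<Rightarrow> nat \<Rightarrow> bool" where
  "valley \<mu> k \<longleftrightarrow> 0 < k \<and> k < length \<mu> \<and> \<mu> ! (k - 1) = East \<and> \<mu> ! k = North"

definition next_same_horiz :: "path \<Rightarrow> path \<Rightarrow> nat \<Rightarrow> nat" where
  "next_same_horiz \<nu> \<mu> k =
     (LEAST l. k < l \<and> l \<le> length \<mu> \<and> horiz \<nu> (point \<mu> l) = horiz \<nu> (point \<mu> k))"

definition rotate_at :: "path \<Rightarrow> path \<Rightarrow> nat \<Rightarrow> path" where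
  "rotate_at \<nu> \<mu> k =
     (let l = next_same_horiz \<nu> \<mu> k
      in take (k - 1) \<mu> @ drop k (take l \<mu>) @ [East] @ drop l \<mu>)"

definition nu_rotation :: "path \<Rightarrow> path \<Rightarrow> path \<Rightarrow> bool" where
  "nu_rotation \<nu> \<mu> \<mu>' \<longleftrightarrow>
     \<mu> \<in> nu_paths \<nu> \<and> \<mu>' \<in> nu_paths \<nu> \<and> (\<exists>k. valley \<mu> k \<and> \<mu>' = rotate_at \<nu> \<mu> k)"

text \<open>
  The order of a finite poset is the reflexive transitive closure of its cover relation.
\<close>

definition nu_Tamari_le :: "path \<Rightarrow> path \<Rightarrow> path \<Rightarrow> bool" where
  "nu_Tamari_le \<nu> = (nu_rotation \<nu>)\<^sup>*\<^sup>*"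

section \<open>The map from trees to paths\<close>

text \<open>A node of a tree is represented here by the subtree rooted at it.\<close>

fun rev_preorder :: "tree \<Rightarrow> tree list" where
  "rev_preorder Leaf = [Leaf]"
| "rev_preorder (Node i ts) = Node i ts # concat (rev (map rev_preorder ts))"

fun step_of_node :: "tree \<Rightarrow> step" where
  "step_of_node Leaf = East"
| "step_of_node (Node i ts) = North"

text \<open>
  The node visited last is always a leaf (when every internal node has a child), so
  \<open>butlast\<close> omits the last east step.
\<close>

definition phi :: "tree \<Rightarrow> path" where
  "phi T = butlast (map step_of_node (rev_preorder T))"

text \<open>
  An order isomorphism; between lattices this is the same as a lattice isomorphism.
\<close>

definition order_iso_betw ::
  "('a \<Rightarrow> 'b) \<Rightarrow> 'a set \<Rightarrow> ('a \<Rightarrow> 'a \<Rightarrow> bool) \<Rightarrow> 'b set \<Rightarrow> ('b \<Rightarrow> 'b \<Rightarrow> bool) \<Rightarrow> bool" where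
  "order_iso_betw f A leA B leB \<longleftrightarrow>
     bij_betw f A B \<and> (\<forall>x \<in> A. \<forall>y \<in> A. leA x y \<longleftrightarrow> leB (f x) (f y))"

end

theory Submission
  imports Defs "HOL-Library.Multiset"
begin

text \<open>
  In an s-Tamari tree the reversed preorder visits the internal nodes in the order n, ..., 1; so the
  tree is determined by its path, from which it is recovered by the usual stack parsing of such
  words. Let h(y) be the horizontal distance of the path just before the north step of node y.
  This is the number of pending nodes of the traversal minus one, and so for x < y the
  cardinality of (y, x) is the truncated difference of the minimum of h on [x, y) and h(y).
  A rotation raises h by one on a block of labels (L, K] on which h is at least h(K), and above it
  for labels other than K, while h(L) is at most h(K); this can only increase the cardinalities.
  Conversely, if the cardinalities of h are at most those of g and h is not g, then h is at most g
  pointwise, and the rotation at the largest K with h(K) < g(K) is possible and stays below g.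
\<close>

section \<open>Minima over intervals\<close>

definition min_on :: "(nat \<Rightarrow> nat) \<Rightarrow> nat \<Rightarrow> nat \<Rightarrow> nat" where
  "min_on h x y = Min (h ` {x..<y})"

lemma min_on_Suc: "x < y \<Longrightarrow> min_on h x (Suc y) = min (h y) (min_on h x y)"
  by (simp add: min_on_def atLeastLessThanSuc)

lemma min_on_single [simp]: "min_on h x (Suc x) = h x"
  by (simp add: min_on_def)

lemma min_on_ge_iff: "x < y \<Longrightarrow> v \<le> min_on h x y \<longleftrightarrow> (\<forall>j\<in>{x..<y}. v \<le> h j)"
  by (simp add: min_on_def)

lemma min_on_le: "x \<le> j \<Longrightarrow> j < y \<Longrightarrow> min_on h x y \<le> h j"
  by (simp add: min_on_def)

lemma min_on_cong: "(\<And>j. x \<le> j \<Longrightarrow> j < y \<Longrightarrow> g j = h j) \<Longrightarrow> min_on g x y = min_on h x y"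
  unfolding min_on_def by (rule arg_cong[where f = Min]) auto

lemma min_on_mono: "x \<le> x' \<Longrightarrow> x' < y \<Longrightarrow> min_on h x y \<le> min_on h x' y"
  by (auto simp: min_on_def intro!: Min_antimono)

lemma min_on_attained: "x < y \<Longrightarrow> \<exists>j\<in>{x..<y}. h j = min_on h x y"
  unfolding min_on_def using Min_in[of "h ` {x..<y}"] by fastforce

lemma min_on_leI:
  "x < y \<Longrightarrow> (\<And>j. x \<le> j \<Longrightarrow> j < y \<Longrightarrow> \<exists>i. x \<le> i \<and> i < y \<and> h i \<le> g j) \<Longrightarrow>
     min_on h x y \<le> min_on g x y"
  using min_on_ge_iff[of x y "min_on h x y" g] min_on_le[of x _ y h] by (meson atLeastLessThan_iff le_trans)

section \<open>Words and forests\<close>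

text \<open>
  Here t lists the east step counts of the rows that are still to come, and c is the current
  horizontal distance. The north steps are labelled by \<open>length t\<close>, ..., 1 along the path.
\<close>

fun nu_word :: "nat list \<Rightarrow> nat \<Rightarrow> path \<Rightarrow> bool" where
  "nu_word t c [] \<longleftrightarrow> t = [] \<and> c = 0"
| "nu_word t c (East # w) \<longleftrightarrow> 0 < c \<and> nu_word t (c - 1) w"
| "nu_word [] c (North # w) \<longleftrightarrow> False"
| "nu_word (a # t) c (North # w) \<longleftrightarrow> nu_word t (c + a) w"

text \<open>The value at \<open>j\<close> is the distance just before the north step labelled
  \<open>j\<close>. It is 0 at every \<open>j\<close> that labels no north step of \<open>w\<close>,
  so unfinished words are allowed too.\<close>

fun node_horiz :: "nat list \<Rightarrow> nat \<Rightarrow> path \<Rightarrow> nat \<Rightarrow> nat" where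
  "node_horiz t c [] = (\<lambda>_. 0)"
| "node_horiz t c (East # w) = node_horiz t (c - 1) w"
| "node_horiz [] c (North # w) = (\<lambda>_. 0)"
| "node_horiz (a # t) c (North # w) = (node_horiz t (c + a) w)(Suc (length t) := c)"

text \<open>Only east steps precede the north step labelled \<open>length t\<close>, and they can
  only lower the distance.\<close>

lemma node_horiz_top: "t \<noteq> [] \<Longrightarrow> node_horiz t c w (length t) \<le> c"
  by (induction t c w rule: node_horiz.induct) (auto intro: le_trans)

lemma node_horiz_outside: "length t < j \<or> j = 0 \<Longrightarrow> node_horiz t c w j = 0"
  by (induction t c w rule: node_horiz.induct) auto

text \<open>The trees of a forest are listed in the order of the traversal, that is, right to left, and
  w is their path without the last east step.\<close>

inductive forest :: "nat list \<Rightarrow> tree list \<Rightarrow> path \<Rightarrow> bool" where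
  base: "forest [] [Leaf] []"
| leaf: "forest t fs w \<Longrightarrow> forest t (Leaf # fs) (East # w)"
| node: "forest t (rev ts @ fs) w \<Longrightarrow> length ts = Suc a \<Longrightarrow>
    forest (a # t) (Node (Suc (length t)) ts # fs) (North # w)"

lemma forest_nonempty: "forest t fs w \<Longrightarrow> fs \<noteq> []"
  by (induction rule: forest.induct) auto

text \<open>A leaf removes one pending tree and a node with \<open>Suc a\<close> children adds
  \<open>a\<close> of them, which is how the distance changes along the word.\<close>

lemma forest_nu_word: "forest t fs w \<Longrightarrow> nu_word t (length fs - 1) w"
proof (induction rule: forest.induct)
  case (leaf t fs w)
  then show ?case using forest_nonempty[OF leaf.hyps] by (cases fs) auto
qed (auto simp: add.commute)

text \<open>The word is parsed from its end: an east step puts a leaf in front of the forest, and a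
  north step makes the first \<open>Suc a\<close> trees the children of a new node, reversed because
  the forest lists them right to left.\<close>

lemma forest_exists:
  "nu_word t c w \<Longrightarrow> \<exists>fs. length fs = Suc c \<and> forest t fs w"
proof (induction t c w rule: nu_word.induct)
  case (1 t c)
  then show ?case by (auto intro!: exI[of _ "[Leaf]"] forest.base)
next
  case (2 t c w)
  then obtain fs where "length fs = c" "forest t fs w" by auto
  then show ?case by (intro exI[of _ "Leaf # fs"]) (auto intro: forest.leaf)
next
  case (3 c w)
  then show ?case by simp
next
  case (4 a t c w)
  then obtain fs where fs: "length fs = Suc (c + a)" "forest t fs w" by auto
  let ?T = "Node (Suc (length t)) (rev (take (Suc a) fs))"
  have "forest (a # t) (?T # drop (Suc a) fs) (North # w)"
    using fs by (intro forest.node) auto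
  with fs show ?case by (intro exI[of _ "?T # drop (Suc a) fs"]) auto
qed

text \<open>The first step selects the rule and \<open>t\<close> fixes the arity, so there is only
  one parse.\<close>

lemma forest_unique: "forest t fs w \<Longrightarrow> forest t fs' w \<Longrightarrow> fs = fs'"
proof (induction arbitrary: fs' rule: forest.induct)
  case base
  then show ?case by (auto elim: forest.cases)
next
  case (leaf t fs w)
  from leaf.prems show ?case by (cases rule: forest.cases) (auto dest: leaf.IH)
next
  case (node t ts fs w a)
  from node.prems show ?case
  proof (cases rule: forest.cases)
    case (node us gs)
    then have "rev ts @ fs = rev us @ gs" using node.IH by blast
    then show ?thesis using node \<open>length ts = Suc a\<close> by auto
  qed
qed

section \<open>Paths, labels and arities of a forest\<close>

definition word :: "tree list \<Rightarrow> path" where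
  "word fs = concat (map (\<lambda>T. map step_of_node (rev_preorder T)) fs)"

lemma word_simps [simp]:
  "word [] = []"
  "word (Leaf # fs) = East # word fs"
  "word (Node i ts # fs) = North # word (rev ts @ fs)"
  by (simp_all add: word_def map_concat rev_map comp_def)

text \<open>\<open>word\<close> keeps the east step of the very last leaf, which the base rule omits
  from \<open>w\<close>; this is the step that \<open>phi\<close> drops.\<close>

lemma forest_word: "forest t fs w \<Longrightarrow> word fs = w @ [East]"
  by (induction rule: forest.induct) auto

lemma forest_phi: "forest t [T] w \<Longrightarrow> phi T = w"
  using forest_word[of t "[T]" w] by (simp add: phi_def word_def)

text \<open>With multisets, one equation yields both the set of labels and their
  distinctness.\<close>

lemma forest_labels:
  "forest t fs w \<Longrightarrow> mset (concat (map labels fs)) = mset [1..<Suc (length t)]"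
  by (induction rule: forest.induct) (auto simp: mset_concat rev_map[symmetric] sum_mset_sum_list[symmetric])

lemma forest_label_set:
  assumes "forest t fs w"
  shows "(\<Union>T\<in>set fs. set (labels T)) = {1..length t}"
  using arg_cong[OF forest_labels[OF assms], of set_mset] by auto

definition forest_subtrees :: "tree list \<Rightarrow> tree set" where
  "forest_subtrees fs = (\<Union>T\<in>set fs. subtrees T)"

lemma forest_subtrees_simps [simp]:
  "forest_subtrees [] = {}"
  "forest_subtrees (Leaf # fs) = insert Leaf (forest_subtrees fs)"
  "forest_subtrees (Node i ts # fs) = insert (Node i ts) (forest_subtrees (rev ts @ fs))"
  by (auto simp: forest_subtrees_def)

text \<open>Labels descend along \<open>t\<close>, so the row of node \<open>i\<close> is entry
  \<open>i - 1\<close> of \<open>rev t\<close>, and putting a new row in front of \<open>t\<close>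
  does not move it. The descendants of a new node carry labels from \<open>{1..length t}\<close>,
  hence smaller ones.\<close>

lemma forest_arity:
  "forest t fs w \<Longrightarrow> Node i ts \<in> forest_subtrees fs \<Longrightarrow>
     1 \<le> i \<and> i \<le> length t \<and> length ts = Suc (rev t ! (i - 1)) \<and>
     (\<forall>T\<in>set ts. \<forall>x\<in>set (labels T). x < i)"
proof (induction arbitrary: i ts rule: forest.induct)
  case (node t us fs w a)
  show ?case
  proof (cases "Node i ts \<in> forest_subtrees (rev us @ fs)")
    case True
    from node.IH[OF this] show ?thesis by (auto simp: nth_append)
  next
    case False
    with node.prems have *: "i = Suc (length t)" "ts = us" by auto
    have "x < i" if "T \<in> set ts" "x \<in> set (labels T)" for T x
    proof -
      have "x \<in> (\<Union>T\<in>set (rev us @ fs). set (labels T))" using that * by auto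
      then show ?thesis unfolding forest_label_set[OF node.hyps(1)] * by auto
    qed
    with * node.hyps show ?thesis by (auto simp: nth_append)
  qed
qed auto

lemma forest_s_decreasing:
  assumes "forest (rev s) [T] w"
  shows "s_decreasing_tree s T"
proof -
  have "mset (labels T) = mset [1..<Suc (length s)]"
    using forest_labels[OF assms] by simp
  then have "distinct (labels T)" "set (labels T) = set [1..<Suc (length s)]"
    by (metis distinct_upt mset_eq_imp_distinct_iff, metis mset_eq_setD)
  moreover have "length ts = part s i + 1 \<and> (\<forall>t\<in>set ts. \<forall>x\<in>set (labels t). x < i)"
    if "Node i ts \<in> subtrees T" for i ts
    using forest_arity[OF assms, of i ts] that by (simp add: Defs.part_def forest_subtrees_def)
  ultimately show ?thesis unfolding s_decreasing_tree_def by auto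
qed

text \<open>The tree of the forest that contains x is the one on top of the stack of pending trees when
  this stack is at its lowest before x is visited.\<close>

lemma forest_label_iff:
  "forest t fs w \<Longrightarrow> 1 \<le> x \<Longrightarrow> x \<le> length t \<Longrightarrow> q < length fs \<Longrightarrow>
    x \<in> set (labels (fs ! q)) \<longleftrightarrow>
    min_on (node_horiz t (length fs - 1) w) x (Suc (length t)) + q + 1 = length fs"
proof (induction arbitrary: q rule: forest.induct)
  case base
  then show ?case by simp
next
  case (leaf t fs w)
  let ?h = "node_horiz t (length fs - 1) w"
  have "?h (length t) \<le> length fs - 1" using leaf.prems by (intro node_horiz_top) auto
  then have le: "min_on ?h x (Suc (length t)) \<le> length fs - 1"
    using min_on_le[of x "length t" "Suc (length t)" ?h] leaf.prems by simp
  obtain f fs' where "fs = f # fs'" using forest_nonempty[OF leaf.hyps] by (cases fs) auto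
  then show ?case using le leaf.IH[of "q - 1"] leaf.prems by (cases q) auto
next
  case (node t ts fs w a)
  define h where "h = node_horiz t (length fs + a) w"
  define h' where "h' = h(Suc (length t) := length fs)"
  have len: "node_horiz t (length (rev ts @ fs) - 1) w = h" using node.hyps by (simp add: h_def add.commute)
  have h': "node_horiz (a # t) (length (Node (Suc (length t)) ts # fs) - 1) (North # w) = h'"
    by (simp add: h_def h'_def)
  have top: "h (length t) \<le> length fs + a" if "1 \<le> x" "x \<le> length t"
    unfolding h_def using that by (intro node_horiz_top) auto
  have h'_at [simp]: "h' (Suc (length t)) = length fs" by (simp add: h'_def)
  show ?case
  proof (cases "x = Suc (length t)")
    case True
    have "x \<notin> set (labels (fs ! (q - 1)))" if "q > 0"
    proof
      assume "x \<in> set (labels (fs ! (q - 1)))"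
      then have "x \<in> (\<Union>T\<in>set (rev ts @ fs). set (labels T))"
        using that node.prems by (auto intro!: bexI[of _ "fs ! (q - 1)"])
      then show False unfolding forest_label_set[OF node.hyps(1)] using True by auto
    qed
    then show ?thesis unfolding h' using True by (cases q) auto
  next
    case False
    then have x: "x \<le> length t" using node.prems by simp
    let ?m = "min_on h x (Suc (length t))"
    have IH: "x \<in> set (labels ((rev ts @ fs) ! p)) \<longleftrightarrow> ?m + p = length fs + a"
      if "p < length ts + length fs" for p
      using node.IH[of p, unfolded len] that x node.prems node.hyps(2) by (simp add: add.commute)
    have "min_on h' x (Suc (length t)) = ?m"
      by (rule min_on_cong) (simp add: h'_def)
    \<comment> \<open>The new node caps the minimum at \<open>length fs\<close>. Its children,
      formerly the first \<open>length ts\<close> positions, thereby merge into position 0, and the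
      trees of \<open>fs\<close> move up accordingly.\<close>
    then have m: "min_on h' x (Suc (Suc (length t))) = min (length fs) ?m"
      using min_on_Suc[of x "Suc (length t)" h'] x by simp
    show ?thesis
    proof (cases q)
      case 0
      have "x \<in> set (labels (Node (Suc (length t)) ts)) \<longleftrightarrow> (\<exists>p<length ts. x \<in> set (labels (rev ts ! p)))"
        using False in_set_conv_nth[of _ "rev ts"] by (auto; metis)
      also have "\<dots> \<longleftrightarrow> (\<exists>p<length ts. ?m + p = length fs + a)"
      proof -
        have "x \<in> set (labels (rev ts ! p)) \<longleftrightarrow> ?m + p = length fs + a" if "p < length ts" for p
          using IH[of p] that by (simp add: nth_append)
        then show ?thesis by blast
      qed
      also have "\<dots> \<longleftrightarrow> length fs \<le> ?m"
      proof
        assume "length fs \<le> ?m"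
        moreover have "?m \<le> length fs + a"
          using top min_on_le[of x "length t" "Suc (length t)" h] x node.prems by auto
        ultimately show "\<exists>p<length ts. ?m + p = length fs + a"
          using node.hyps(2) by (intro exI[of _ "length fs + a - ?m"]) auto
      qed (use node.hyps(2) in auto)
      finally show ?thesis unfolding h' using 0 m by auto
    next
      case (Suc p)
      then have "x \<in> set (labels (fs ! p)) \<longleftrightarrow> ?m + (p + length ts) = length fs + a"
        using IH[of "p + length ts"] node.prems by (simp add: nth_append)
      then show ?thesis unfolding h' using Suc m node.hyps(2) by auto
    qed
  qed
qed

section \<open>Child positions and cardinalities in a forest\<close>

definition in_child_of :: "tree list \<Rightarrow> nat \<Rightarrow> nat \<Rightarrow> nat \<Rightarrow> bool" where
  "in_child_of fs y i x \<longleftrightarrow>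
     (\<exists>ts. Node y ts \<in> forest_subtrees fs \<and> i < length ts \<and> x \<in> set (labels (ts ! i)))"

lemma in_child_of_Leaf [simp]: "in_child_of (Leaf # fs) = in_child_of fs"
  by (auto simp: in_child_of_def fun_eq_iff)

lemma in_child_of_Node [simp]:
  "in_child_of (Node z ts # fs) y i x \<longleftrightarrow>
     in_child_of (rev ts @ fs) y i x \<or> y = z \<and> i < length ts \<and> x \<in> set (labels (ts ! i))"
  by (auto simp: in_child_of_def)

lemma labels_subtree: "S \<in> subtrees T \<Longrightarrow> set (labels S) \<subseteq> set (labels T)"
  by (induction T) auto

lemma in_child_of_labels:
  assumes "forest t fs w" "in_child_of fs y i x"
  shows "1 \<le> x \<and> x < y \<and> y \<le> length t"
proof -
  from assms(2) obtain ts where ts: "Node y ts \<in> forest_subtrees fs" "i < length ts" "x \<in> set (labels (ts ! i))"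
    by (auto simp: in_child_of_def)
  then have "x \<in> (\<Union>T\<in>set fs. set (labels T))"
    unfolding forest_subtrees_def using labels_subtree nth_mem by fastforce
  with forest_arity[OF assms(1) ts(1)] ts(2,3) show ?thesis
    unfolding forest_label_set[OF assms(1)] by auto
qed

text \<open>When \<open>y\<close> is visited, \<open>h y\<close> other trees are pending. Its
  children go on top of them with the rightmost first, so child \<open>i\<close> is at position
  \<open>a - i\<close>; by \<open>forest_label_iff\<close>, \<open>x\<close> lies there iff the
  minimum over the labels from \<open>x\<close> to \<open>y - 1\<close> is
  \<open>h y + i\<close>.\<close>

lemma forest_in_child_iff:
  "forest t fs w \<Longrightarrow> in_child_of fs y i x \<longleftrightarrow>
     1 \<le> x \<and> x < y \<and> y \<le> length t \<and>
     min_on (node_horiz t (length fs - 1) w) x y = node_horiz t (length fs - 1) w y + i"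
proof (induction rule: forest.induct)
  case base
  then show ?case by (auto simp: in_child_of_def)
next
  case (leaf t fs w)
  then show ?case using forest_nonempty by (cases fs) auto
next
  case (node t ts fs w a)
  define h where "h = node_horiz t (length fs + a) w"
  define h' where "h' = h(Suc (length t) := length fs)"
  have len: "node_horiz t (length (rev ts @ fs) - 1) w = h" using node.hyps by (simp add: h_def add.commute)
  have h': "node_horiz (a # t) (length (Node (Suc (length t)) ts # fs) - 1) (North # w) = h'"
    by (simp add: h_def h'_def)
  have top: "h (length t) \<le> length fs + a" if "1 \<le> x" "x \<le> length t"
    unfolding h_def using that by (intro node_horiz_top) auto
  have h'_at [simp]: "h' (Suc (length t)) = length fs" "j \<le> length t \<Longrightarrow> h' j = h j" for j
    by (simp_all add: h'_def)
  show ?case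
  proof (cases "y = Suc (length t)")
    case True
    have no: "\<not> in_child_of (rev ts @ fs) y i x"
      using in_child_of_labels[OF node.hyps(1)] True by fastforce
    show ?thesis
    proof (cases "1 \<le> x \<and> x \<le> length t")
      case x: True
      have m: "min_on h' x y = min_on h x y"
        by (rule min_on_cong) (use True in \<open>simp add: h'_def\<close>)
      have le: "min_on h x y \<le> length fs + a"
        using top min_on_le[of x "length t" "Suc (length t)" h] x True by simp
      have "x \<in> set (labels (ts ! i)) \<longleftrightarrow> min_on h x y = length fs + i" if "i < length ts"
      proof -
        have "a - i < length ts" using node.hyps(2) by simp
        then have "ts ! i = (rev ts @ fs) ! (a - i)" using that node.hyps(2) by (simp add: nth_append rev_nth)
        then show ?thesis
          using forest_label_iff[OF node.hyps(1), of x "a - i", unfolded len] x that node.hyps(2) True by auto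
      qed
      then show ?thesis unfolding h' using no True x m le node.hyps(2) by auto
    next
      case x: False
      have "x \<notin> set (labels (ts ! i))" if "i < length ts"
      proof
        assume "x \<in> set (labels (ts ! i))"
        then have "x \<in> (\<Union>T\<in>set (rev ts @ fs). set (labels T))"
          using that by (auto intro!: bexI[of _ "ts ! i"])
        then show False unfolding forest_label_set[OF node.hyps(1)] using x by auto
      qed
      then show ?thesis unfolding h' using no True x by auto
    qed
  next
    case False
    have "min_on h' x y = min_on h x y" if "y \<le> length t"
      by (rule min_on_cong) (use that in \<open>simp add: h'_def\<close>)
    then show ?thesis unfolding h' using node.IH[unfolded len] False by auto
  qed
qed

text \<open>If the minimum is at least \<open>h y\<close>, then \<open>x\<close> is a descendant of
  \<open>y\<close> and the difference is the child index. Otherwise \<open>x\<close>, being visited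
  after \<open>y\<close>, lies left of \<open>y\<close>, and the truncated difference is 0.\<close>

lemma forest_inv_card:
  assumes F: "forest (rev s) [T] w" and xy: "1 \<le> x" "x < y" "y \<le> length s"
  defines "h \<equiv> node_horiz (rev s) 0 w"
  shows "inv_card s T y x = min_on h x y - h y"
proof -
  have ic: "in_child T b i a \<longleftrightarrow> 1 \<le> a \<and> a < b \<and> b \<le> length s \<and> min_on h a b = h b + i" for a b i
    using forest_in_child_iff[OF F, of b i a] by (simp add: in_child_of_def in_child_def forest_subtrees_def h_def)
  have de: "descendant T a b \<longleftrightarrow> 1 \<le> a \<and> a < b \<and> b \<le> length s \<and> (\<forall>j\<in>{a..<b}. h b \<le> h j)" for a b
    unfolding descendant_def ic using min_on_ge_iff[of a b "h b" h] by (metis le_Suc_ex le_add1)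
  show ?thesis
  proof (cases "descendant T x y")
    case True
    then have "h y \<le> min_on h x y" unfolding de using min_on_ge_iff by blast
    then have "(THE i. in_child T y i x) = min_on h x y - h y"
      using xy by (intro the_equality) (auto simp: ic)
    then show ?thesis using True by (simp add: inv_card_def left_of_def)
  next
    case False
    then have lt: "min_on h x y < h y" unfolding de using min_on_ge_iff[of x y "h y" h] xy by auto
    have top: "h (length s) = 0" using node_horiz_top[of "rev s" 0 w] xy by (cases s) (auto simp: h_def)
    have yn: "y < length s" using lt xy top by (cases "y = length s") auto
    \<comment> \<open>The closest common ancestor is the first label after \<open>y\<close> at which
      the height is down to the minimum over the labels from \<open>x\<close> to
      \<open>y - 1\<close>. It exists because the root \<open>length s\<close> has height 0.\<close>
    define z where "z = (LEAST z. y < z \<and> h z \<le> min_on h x y)"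
    have zP: "y < z \<and> h z \<le> min_on h x y"
      unfolding z_def by (rule LeastI[of _ "length s"]) (use yn top in auto)
    have zn: "z \<le> length s"
      unfolding z_def by (rule Least_le) (use yn top in auto)
    have zmin: "min_on h x y < h j" if "y < j" "j < z" for j
      using not_less_Least[of j "\<lambda>z. y < z \<and> h z \<le> min_on h x y"] that unfolding z_def by auto
    have ge: "min_on h x y \<le> h j" if "x \<le> j" "j < z" for j
      using min_on_le[of x j y h] zmin[of j] lt that by (cases j y rule: linorder_cases) auto
    have "descendant T x z" "descendant T y z"
      unfolding de using xy zP zn ge by (auto intro: le_trans)
    \<comment> \<open>A common ancestor \<open>v\<close> below \<open>z\<close> would also have
      height at most this minimum, against the choice of \<open>z\<close>.\<close>
    moreover have "\<not> descendant T v z" if "common_ancestor T v x y" for v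
    proof
      assume "descendant T v z"
      with that have v: "y < v" "v < z" "h v \<le> h j" if "x \<le> j" "j < v" for j
        using that unfolding common_ancestor_def de by auto
      from min_on_attained[of x y h] xy obtain j where j: "x \<le> j" "j < y" "h j = min_on h x y" by auto
      have "y < v" "v < z" using \<open>descendant T v z\<close> that unfolding common_ancestor_def de by auto
      with v(3)[of j] zmin[of v] j show False by auto
    qed
    ultimately have cca: "closest_common_ancestor T z x y"
      unfolding closest_common_ancestor_def common_ancestor_def by auto
    \<comment> \<open>From \<open>y\<close> up to \<open>z - 1\<close> all heights exceed the
      minimum for \<open>x\<close>, so \<open>x\<close> lies in a child of \<open>z\<close> with a
      smaller index than that of \<open>y\<close>.\<close>
    have "min_on h x z = min_on h x y"
    proof (rule antisym)
      show "min_on h x y \<le> min_on h x z" using min_on_ge_iff[of x z "min_on h x y" h] ge xy zP by auto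
      from min_on_attained[of x y h] xy obtain j where j: "x \<le> j" "j < y" "h j = min_on h x y" by auto
      then show "min_on h x z \<le> min_on h x y" using min_on_le[of x j z h] zP by auto
    qed
    moreover have "min_on h x y < min_on h y z"
    proof -
      from min_on_attained[of y z h] zP obtain j where "y \<le> j" "j < z" "h j = min_on h y z" by auto
      then show ?thesis using lt zmin[of j] by (cases "j = y") auto
    qed
    moreover from this calculation
    have "in_child T z (min_on h x z - h z) x" "in_child T z (min_on h y z - h z) y"
      unfolding ic using xy zP zn by auto
    ultimately have "left_of T x y"
      unfolding left_of_def using False cca zP by (metis diff_less_mono)
    then show ?thesis using lt by (simp add: inv_card_def)
  qed
qed

text \<open>Moving the left end of the interval from \<open>a\<close> to \<open>b\<close> can only
  raise the minimum; this is the Tamari inequality.\<close>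

lemma forest_Tamari: "forest (rev s) [T] w \<Longrightarrow> T \<in> s_Tamari_trees s"
  by (auto simp: s_Tamari_trees_def forest_s_decreasing forest_inv_card intro!: diff_le_mono min_on_mono)

section \<open>Labels in reversed preorder and uniqueness of child positions\<close>

fun rlabels :: "tree \<Rightarrow> nat list" where
  "rlabels Leaf = []"
| "rlabels (Node i ts) = i # concat (rev (map rlabels ts))"

lemma mset_rlabels: "mset (rlabels T) = mset (labels T)"
proof (induction T)
  case (Node i ts)
  then show ?case by (simp add: mset_concat rev_map[symmetric] comp_def cong: map_cong)
qed simp

lemma set_rlabels: "set (rlabels T) = set (labels T)"
  by (metis mset_rlabels mset_eq_setD)

lemma distinct_concat_index:
  "distinct (concat (map f us)) \<Longrightarrow> i < length us \<Longrightarrow> j < length us \<Longrightarrow>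
    x \<in> set (f (us ! i)) \<Longrightarrow> x \<in> set (f (us ! j)) \<Longrightarrow> i = j"
proof (induction us arbitrary: i j)
  case (Cons u us)
  then show ?case by (cases i; cases j) (auto; meson UN_I disjoint_iff nth_mem)+
qed simp

lemma distinct_concat_member:
  "distinct (concat (map f us)) \<Longrightarrow> t \<in> set us \<Longrightarrow> distinct (f t)"
  by (induction us) auto

text \<open>Different children have disjoint label sets, so two nodes with the same label lie in the
  same child, and induction applies.\<close>

lemma subtree_unique:
  "distinct (labels T) \<Longrightarrow> Node y ts \<in> subtrees T \<Longrightarrow> Node y us \<in> subtrees T \<Longrightarrow> ts = us"
proof (induction T)
  case (Node i vs)
  have top: "y \<noteq> i" if "v \<in> set vs" "Node y xs \<in> subtrees v" for v xs
    using that labels_subtree[of "Node y xs" v] Node.prems(1) by auto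
  show ?case
  proof (cases "y = i")
    case True
    then show ?thesis using Node.prems top by auto
  next
    case False
    with Node.prems(2) obtain k where k: "k < length vs" "Node y ts \<in> subtrees (vs ! k)"
      by (auto simp: in_set_conv_nth)
    from False Node.prems(3) obtain l where l: "l < length vs" "Node y us \<in> subtrees (vs ! l)"
      by (auto simp: in_set_conv_nth)
    have "y \<in> set (labels (vs ! k))" "y \<in> set (labels (vs ! l))"
      using labels_subtree[OF k(2)] labels_subtree[OF l(2)] by auto
    then have "k = l"
      using distinct_concat_index[of labels vs k l y] k l Node.prems(1) by simp
    moreover have "distinct (labels (vs ! k))"
      using distinct_concat_member[of labels vs "vs ! k"] Node.prems(1) k(1) by simp
    ultimately show ?thesis using Node.IH[of "vs ! k"] k l by simp
  qed
qed simp

lemma distinct_labels_subtree: "distinct (labels T) \<Longrightarrow> S \<in> subtrees T \<Longrightarrow> distinct (labels S)"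
proof (induction T)
  case (Node i ts)
  show ?case
  proof (cases "S = Node i ts")
    case False
    with Node.prems obtain t where "t \<in> set ts" "S \<in> subtrees t" by auto
    then show ?thesis using Node distinct_concat_member[of labels ts t] by auto
  qed (use Node.prems in simp)
qed simp

lemma in_child_unique:
  assumes "distinct (labels T)" "in_child T y i x" "in_child T y j x"
  shows "i = j"
proof -
  from assms(2) obtain ts where ts: "Node y ts \<in> subtrees T" "i < length ts" "x \<in> set (labels (ts ! i))"
    unfolding in_child_def by blast
  from assms(3) obtain us where us: "Node y us \<in> subtrees T" "j < length us" "x \<in> set (labels (us ! j))"
    unfolding in_child_def by blast
  have "us = ts" using subtree_unique[OF assms(1) us(1) ts(1)] .
  moreover have "distinct (concat (map labels ts))"
    using distinct_labels_subtree[OF assms(1) ts(1)] by simp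
  ultimately show ?thesis using distinct_concat_index[of labels ts i j x] ts us by simp
qed

text \<open>Only distinct labels are assumed: this serves to read the Tamari inequality in a tree
  not yet known to come from a forest.\<close>

lemma inv_card_in_child:
  assumes "distinct (labels T)" "in_child T y i x"
  shows "inv_card s T y x = i"
proof -
  have "(THE j. in_child T y j x) = i"
    by (rule the_equality[where P = "\<lambda>j. in_child T y j x", OF assms(2)])
      (rule in_child_unique[OF assms(1) _ assms(2)])
  moreover have "descendant T x y" using assms(2) by (auto simp: descendant_def)
  ultimately show ?thesis by (simp add: inv_card_def left_of_def)
qed

section \<open>Tamari trees as forests\<close>

lemma sorted_concat_rev:
  "(\<And>x. x \<in> set xs \<Longrightarrow> sorted_wrt R (f x)) \<Longrightarrow>
   (\<And>i j a b. i < j \<Longrightarrow> j < length xs \<Longrightarrow> a \<in> set (f (xs ! j)) \<Longrightarrow> b \<in> set (f (xs ! i)) \<Longrightarrow> R a b) \<Longrightarrow>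
   sorted_wrt R (concat (rev (map f xs)))"
proof (induction xs)
  case (Cons x xs)
  have "R a b" if "a \<in> set (f y)" "y \<in> set xs" "b \<in> set (f x)" for a b y
  proof -
    from that obtain j where "j < length xs" "y = xs ! j" by (auto simp: in_set_conv_nth)
    then show ?thesis by (intro Cons.prems(2)[of 0 "Suc j"]) (use that in auto)
  qed
  moreover have "sorted_wrt R (concat (rev (map f xs)))"
  proof (rule Cons.IH)
    show "R a b" if "i < j" "j < length xs" "a \<in> set (f (xs ! j))" "b \<in> set (f (xs ! i))" for i j a b
      by (rule Cons.prems(2)[of "Suc i" "Suc j"]) (use that in auto)
  qed (use Cons.prems(1) in simp)
  moreover have "sorted_wrt R (f x)" using Cons.prems(1) by simp
  ultimately show ?case by (auto simp: sorted_wrt_append)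
qed simp

lemma subtrees_refl [simp]: "T \<in> subtrees T"
  by (cases T) auto

lemma subtrees_trans: "S \<in> subtrees T \<Longrightarrow> U \<in> subtrees S \<Longrightarrow> U \<in> subtrees T"
  by (induction T) auto

text \<open>Let \<open>a\<close> and \<open>b\<close> lie in the children \<open>j\<close> and
  \<open>i\<close> of \<open>z\<close> with \<open>i < j\<close>. Their cardinalities are
  \<open>j\<close> and \<open>i\<close>, so \<open>a < b\<close> would violate the Tamari
  inequality. Hence the labels decrease from right to left across the children.\<close>

lemma Tamari_sorted:
  assumes T: "T \<in> s_Tamari_trees s"
  shows "S \<in> subtrees T \<Longrightarrow> sorted_wrt (>) (rlabels S)"
proof (induction S)
  case (Node z ts)
  have D: "distinct (labels T)" "set (labels T) = {1..length s}"
    using T unfolding s_Tamari_trees_def s_decreasing_tree_def by auto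
  have dec: "x < z" if "t \<in> set ts" "x \<in> set (labels t)" for t x
    using T Node.prems that unfolding s_Tamari_trees_def s_decreasing_tree_def by auto
  have lab: "x \<in> {1..length s}" if "x \<in> set (labels (Node z ts))" for x
    using labels_subtree[OF Node.prems] that D by auto
  have cross: "a > b" if ij: "i < j" "j < length ts"
    and ab: "a \<in> set (rlabels (ts ! j))" "b \<in> set (rlabels (ts ! i))" for i j a b
  proof (rule ccontr)
    assume "\<not> a > b"
    have ch: "in_child T z j a" "in_child T z i b"
      using ij ab Node.prems by (auto simp: in_child_def set_rlabels)
    have "a \<noteq> b" using in_child_unique[OF D(1)] ch ij by auto
    moreover have "b < z" "a < z" using dec[of "ts ! i" b] dec[of "ts ! j" a] ij ab by (auto simp: set_rlabels)
    moreover have "1 \<le> a" "z \<le> length s"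
      using lab[of a] lab[of z] ab(1) nth_mem[OF ij(2)] unfolding set_rlabels by auto
    ultimately have "inv_card s T z a \<le> inv_card s T z b"
      using T \<open>\<not> a > b\<close> unfolding s_Tamari_trees_def by auto
    then show False using inv_card_in_child[OF D(1)] ch ij by auto
  qed
  have inner: "sorted_wrt (>) (rlabels t)" if "t \<in> set ts" for t
  proof -
    have "t \<in> subtrees (Node z ts)" using that by (auto intro: bexI[of _ t])
    then show ?thesis using Node.IH[OF that] subtrees_trans[OF Node.prems] by blast
  qed
  have "sorted_wrt (>) (concat (rev (map rlabels ts)))"
    by (rule sorted_concat_rev[where f = rlabels and xs = ts]) (fact inner, rule cross)
  then show ?case using dec by (auto simp: set_rlabels)
qed simp

text \<open>The traversal is replayed as a derivation of \<open>forest\<close>. Replacing a node by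
  its children may lengthen the list of trees but shortens its word, hence the induction on the
  word. The prescribed label sequence forces the label that the node rule demands.\<close>

lemma forest_of_sorted:
  "fs \<noteq> [] \<Longrightarrow> concat (map rlabels fs) = rev [1..<Suc (length t)] \<Longrightarrow>
   (\<And>i ts. Node i ts \<in> forest_subtrees fs \<Longrightarrow> length ts = Suc (rev t ! (i - 1))) \<Longrightarrow> \<exists>w. forest t fs w"
proof (induction "word fs" arbitrary: t fs rule: length_induct)
  case (1 fs t)
  then have IH: "\<exists>w. forest t' gs w"
    if "length (word gs) < length (word fs)" "gs \<noteq> []" "concat (map rlabels gs) = rev [1..<Suc (length t')]"
      "\<And>i ts. Node i ts \<in> forest_subtrees gs \<Longrightarrow> length ts = Suc (rev t' ! (i - 1))" for gs t'
    using that by blast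
  obtain T gs where fs: "fs = T # gs" using 1 by (cases fs) auto
  show ?case
  proof (cases T)
    case Leaf
    show ?thesis
    proof (cases "gs = []")
      case True
      then have "t = []" using 1(3) fs Leaf by (cases t) auto
      then show ?thesis using True fs Leaf forest.base by auto
    next
      case False
      then have "\<exists>w. forest t gs w" using 1(3,4) fs Leaf by (intro IH) auto
      then show ?thesis using fs Leaf forest.leaf by blast
    qed
  next
    case (Node i ts)
    have eq: "i # concat (map rlabels (rev ts @ gs)) = rev [1..<Suc (length t)]"
      using 1(3) fs Node by (simp add: rev_map)
    then obtain a t' where t: "t = a # t'" by (cases t) auto
    with eq have i: "i = Suc (length t')" and eq': "concat (map rlabels (rev ts @ gs)) = rev [1..<Suc (length t')]"
      by auto
    have len: "length ts = Suc a" using 1(4)[of i ts] fs Node i t by (simp add: nth_append)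
    have "\<exists>w. forest t' (rev ts @ gs) w"
    proof (rule IH)
      show "rev ts @ gs \<noteq> []" using len by auto
    next
      fix j us assume j: "Node j us \<in> forest_subtrees (rev ts @ gs)"
      have "set (labels (Node j us)) \<subseteq> set (concat (map rlabels (rev ts @ gs)))"
        using j labels_subtree unfolding forest_subtrees_def by (fastforce simp: set_rlabels)
      then have "1 \<le> j \<and> j \<le> length t'" unfolding eq' by auto
      then show "length us = Suc (rev t' ! (j - 1))"
        using 1(4)[of j us] j fs Node t by (auto simp: nth_append)
    qed (use fs Node eq' in auto)
    then show ?thesis using forest.node[OF _ len] fs Node t i by auto
  qed
qed

text \<open>A strictly decreasing sequence is determined by its set of entries, so the labels in
  reversed preorder are \<open>length s\<close>, ..., 1.\<close>

lemma s_Tamari_trees_eq: "s_Tamari_trees s = {T. \<exists>w. forest (rev s) [T] w}"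
proof (intro set_eqI iffI CollectI)
  fix T assume T: "T \<in> s_Tamari_trees s"
  then have D: "distinct (labels T)" "set (labels T) = {1..length s}"
    and ar: "\<And>i ts. Node i ts \<in> subtrees T \<Longrightarrow> length ts = part s i + 1"
    unfolding s_Tamari_trees_def s_decreasing_tree_def by auto
  have sorted: "sorted_wrt (>) (rlabels T)"
    by (rule Tamari_sorted[OF T subtrees_refl])
  have 1: "sorted_wrt (<) (rev (rlabels T))"
    by (subst sorted_wrt_rev) (rule sorted)
  have 2: "set (rev (rlabels T)) = set [1..<Suc (length s)]"
    by (simp add: set_rlabels D(2) atLeastLessThanSuc_atLeastAtMost del: upt_Suc)
  have "rev (rlabels T) = [1..<Suc (length s)]"
    by (rule strict_sorted_equal[OF _ 1 2]) (simp del: upt_Suc)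
  then have "rlabels T = rev [1..<Suc (length s)]" by (metis rev_rev_ident)
  then show "\<exists>w. forest (rev s) [T] w"
    by (intro forest_of_sorted) (simp_all add: forest_subtrees_def ar Defs.part_def)
qed (auto dest: forest_Tamari)

section \<open>Paths above a lattice path\<close>

lemma points_Cons:
  "points (North # \<mu>) = insert (0, 0) ((\<lambda>(x, y). (x, Suc y)) ` points \<mu>)"
  "points (East # \<mu>) = insert (0, 0) ((\<lambda>(x, y). (Suc x, y)) ` points \<mu>)"
  by (simp_all add: points_def point_def lessThan_Suc_atMost[symmetric] lessThan_Suc_eq_insert_0
      image_image del: lessThan_Suc)

lemma weakly_above_simps:
  "point_weakly_above [] (x, y) \<longleftrightarrow> x = 0"
  "point_weakly_above (North # \<mu>) (x, y) \<longleftrightarrow> x = 0 \<or> 0 < y \<and> point_weakly_above \<mu> (x, y - 1)"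
  "point_weakly_above (East # \<mu>) (x, y) \<longleftrightarrow> x = 0 \<or> point_weakly_above \<mu> (x - 1, y)"
proof -
  show "point_weakly_above [] (x, y) \<longleftrightarrow> x = 0"
    by (auto simp: point_weakly_above_def points_def point_def)
  show "point_weakly_above (North # \<mu>) (x, y) \<longleftrightarrow> x = 0 \<or> 0 < y \<and> point_weakly_above \<mu> (x, y - 1)"
    by (cases y) (auto simp: point_weakly_above_def points_Cons)
  show "point_weakly_above (East # \<mu>) (x, y) \<longleftrightarrow> x = 0 \<or> point_weakly_above \<mu> (x - 1, y)"
    by (cases x) (auto simp: point_weakly_above_def points_Cons)
qed

lemma weakly_above_0: "point_weakly_above \<mu> (0, y)"
  by (cases \<mu> rule: list.exhaust; cases "hd \<mu>") (auto simp: weakly_above_simps)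

lemma weakly_above_replicate:
  "point_weakly_above (replicate a East @ \<mu>) (x, y) \<longleftrightarrow> x \<le> a \<or> point_weakly_above \<mu> (x - a, y)"
  by (induction a arbitrary: x) (auto simp: weakly_above_simps weakly_above_0)

lemma nu_simps [simp]: "nu [] = []" "nu (a # t) = North # replicate a East @ nu t"
  by (simp_all add: nu_def)

text \<open>The bound is the abscissa of the rightmost point that the path \<open>nu t\<close>
  reaches within its first \<open>y\<close> rows.\<close>

lemma weakly_above_nu: "point_weakly_above (nu t) (x, y) \<longleftrightarrow> x \<le> sum_list (take y t)"
proof (induction t arbitrary: x y)
  case (Cons a t)
  then show ?case by (cases y) (auto simp: weakly_above_simps weakly_above_replicate)
qed (simp add: weakly_above_simps)

lemma horiz_nu:
  assumes "x \<le> sum_list (take y t)"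
  shows "horiz (nu t) (x, y) = sum_list (take y t) - x"
  unfolding horiz_def weakly_above_nu fst_conv snd_conv
proof (rule Max_eqI)
  have "{h. \<forall>j\<le>h. x + j \<le> sum_list (take y t)} \<subseteq> {..sum_list (take y t)}"
    by (auto dest: spec)
  then show "finite {h. \<forall>j\<le>h. x + j \<le> sum_list (take y t)}" by (rule finite_subset) simp
next
  fix h assume "h \<in> {h. \<forall>j\<le>h. x + j \<le> sum_list (take y t)}"
  then have "x + h \<le> sum_list (take y t)" by blast
  then show "h \<le> sum_list (take y t) - x" by simp
qed (use assms in auto)

lemma count_list_replicate: "count_list (replicate n x) y = (if x = y then n else 0)"
  by (induction n) auto

lemma count_nu: "count_list (nu t) East = sum_list t" "count_list (nu t) North = length t"
  by (induction t) (auto simp: count_list_append count_list_replicate)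

lemma all_le_Suc_split: "(\<forall>k\<le>Suc n. P k) \<longleftrightarrow> P 0 \<and> (\<forall>k\<le>n. P (Suc k))"
  by (metis Suc_le_mono less_eq_nat.simps(1) not0_implies_Suc)

text \<open>The counter is \<open>c\<close> plus the rows opened so far minus the east steps taken.
  That it never becomes negative is the condition on prefixes, and that it ends at 0 is the
  condition on the total counts.\<close>

lemma nu_word_iff:
  "nu_word t c w \<longleftrightarrow> count_list w North = length t \<and> count_list w East = c + sum_list t \<and>
     (\<forall>k\<le>length w. count_list (take k w) East \<le> c + sum_list (take (count_list (take k w) North) t))"
proof (induction t c w rule: nu_word.induct)
  case (2 t c w)
  then show ?case unfolding length_Cons all_le_Suc_split by (cases c) auto
next
  case (4 a t c w)
  then show ?case unfolding length_Cons all_le_Suc_split by (auto simp: add.assoc)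
qed auto

lemma nu_paths_eq: "nu_paths (nu t) = {\<mu>. nu_word t 0 \<mu>}"
  by (auto simp: nu_paths_def nu_word_iff points_def point_def weakly_above_nu count_nu)

section \<open>Splitting words and tracking heights\<close>

lemma nu_word_append:
  "nu_word t c (A @ B) \<Longrightarrow>
     nu_word (drop (count_list A North) t) (c + sum_list (take (count_list A North) t) - count_list A East) B"
  by (induction t c A rule: nu_word.induct) (auto simp: add.assoc)

text \<open>What may follow \<open>A\<close> depends only on the rows left and the distance
  reached.\<close>

lemma nu_word_replace:
  "nu_word t c (A @ B) \<Longrightarrow>
     nu_word (drop (count_list A North) t) (c + sum_list (take (count_list A North) t) - count_list A East) B' \<Longrightarrow>
     nu_word t c (A @ B')"
  by (induction t c A rule: nu_word.induct) (auto simp: add.assoc)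

text \<open>The additional unit of distance is carried through \<open>B\<close> and spent by the
  east step after it.\<close>

lemma nu_word_delay_East: "nu_word t c (B @ D) \<Longrightarrow> nu_word t (Suc c) (B @ East # D)"
  by (induction t c B rule: nu_word.induct) auto

lemma nu_word_count:
  assumes "nu_word t c (A @ B)"
  shows "count_list A North \<le> length t"
    and "count_list A East \<le> c + sum_list (take (count_list A North) t)"
proof -
  show "count_list A North \<le> length t" using assms by (auto simp: nu_word_iff count_list_append)
  have "\<forall>k\<le>length (A @ B). count_list (take k (A @ B)) East
      \<le> c + sum_list (take (count_list (take k (A @ B)) North) t)"
    using assms unfolding nu_word_iff by blast
  from this[rule_format, of "length A"]
  show "count_list A East \<le> c + sum_list (take (count_list A North) t)" by simp
qed

text \<open>The north steps of \<open>A\<close> carry the largest labels, and their heights do not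
  depend on what follows; the other labels are met from the state reached after
  \<open>A\<close>.\<close>

lemma node_horiz_append:
  "nu_word t c (A @ B) \<Longrightarrow>
     node_horiz t c (A @ B) j =
      (if j + count_list A North \<le> length t
       then node_horiz (drop (count_list A North) t)
          (c + sum_list (take (count_list A North) t) - count_list A East) B j
       else node_horiz t c A j)"
  by (induction t c A rule: nu_word.induct) (auto simp: add.assoc node_horiz_outside)

text \<open>The word condition keeps the counter positive before each east step of \<open>B\<close>,
  so truncated subtraction commutes with the shift by one.\<close>

lemma node_horiz_Suc:
  "nu_word t c (B @ D) \<Longrightarrow> length t < j + count_list B North \<Longrightarrow> j \<le> length t \<Longrightarrow>
     node_horiz t (Suc c) B j = Suc (node_horiz t c B j)"
  by (induction t c B rule: nu_word.induct) auto

lemma nu_word_split: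
  "nu_word t c w \<Longrightarrow> 1 \<le> j \<Longrightarrow> j \<le> length t \<Longrightarrow>
     \<exists>A B. w = A @ North # B \<and> count_list A North = length t - j \<and>
       node_horiz t c w j = c + sum_list (take (length t - j) t) - count_list A East"
proof (induction t c w rule: nu_word.induct)
  case (2 t c w)
  then obtain A B where "w = A @ North # B" "count_list A North = length t - j"
    "node_horiz t (c - 1) w j = c - 1 + sum_list (take (length t - j) t) - count_list A East" by auto
  with 2 show ?case by (intro exI[of _ "East # A"] exI[of _ B]) auto
next
  case (4 a t c w)
  show ?case
  proof (cases "j = Suc (length t)")
    case True
    then show ?thesis by (intro exI[of _ "[]"] exI[of _ w]) auto
  next
    case False
    with 4 obtain A B where "w = A @ North # B" "count_list A North = length t - j"
      "node_horiz t (c + a) w j = c + a + sum_list (take (length t - j) t) - count_list A East" by auto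
    moreover have "Suc (length t) - j = Suc (length t - j)" using 4 False by simp
    ultimately show ?thesis using False 4 by (intro exI[of _ "North # A"] exI[of _ B]) auto
  qed
qed auto

text \<open>The north step labelled \<open>Suc j\<close> adds the entry of its row, and the east
  steps before the next north step only subtract.\<close>

lemma node_horiz_step:
  "nu_word t c w \<Longrightarrow> 1 \<le> j \<Longrightarrow> j < length t \<Longrightarrow>
     node_horiz t c w j \<le> node_horiz t c w (Suc j) + t ! (length t - Suc j)"
proof (induction t c w rule: nu_word.induct)
  case (4 a t c w)
  show ?case
  proof (cases "j = length t")
    case True
    then show ?thesis using node_horiz_top[of t "c + a" w] 4 by (cases t) auto
  next
    case False
    then have "Suc (length t) - Suc j = Suc (length t - Suc j)" using 4 by simp
    then show ?thesis using False 4 by auto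
  qed
qed auto

text \<open>This is the case of equality in \<open>node_horiz_step\<close>, as no east step
  intervenes.\<close>

lemma node_horiz_North_North:
  assumes "nu_word t c (A @ North # North # B)" "Suc (j + count_list A North) = length t"
  shows "node_horiz t c (A @ North # North # B) j =
    node_horiz t c (A @ North # North # B) (Suc j) + t ! count_list A North"
proof -
  let ?t = "drop (count_list A North) t"
  have l: "nu_word ?t (c + sum_list (take (count_list A North) t) - count_list A East) (North # North # B)"
    using nu_word_append[OF assms(1)] .
  then obtain a b t2 where t: "?t = a # b # t2"
    by (cases ?t rule: list.exhaust; cases "tl ?t" rule: list.exhaust) auto
  then have "t ! count_list A North = a" by (metis nth_via_drop)
  moreover have "length t - count_list A North = Suc (Suc (length t2))"
    using arg_cong[OF t, of length] by simp
  ultimately show ?thesis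
    using assms(2) unfolding node_horiz_append[OF assms(1)] t by auto
qed

text \<open>Where two words first differ, one goes north and has height \<open>c\<close> at the next
  label, while the other goes east and has height at most \<open>c - 1\<close> there.\<close>

lemma node_horiz_inj:
  "nu_word t c w \<Longrightarrow> nu_word t c w' \<Longrightarrow>
     (\<And>j. 1 \<le> j \<Longrightarrow> j \<le> length t \<Longrightarrow> node_horiz t c w j = node_horiz t c w' j) \<Longrightarrow>
     w = w'"
proof (induction t c w arbitrary: w' rule: nu_word.induct)
  case (1 t c)
  then show ?case by (cases "([] :: nat list, 0 :: nat, w')" rule: nu_word.cases) auto
next
  case (2 t c w)
  show ?case
  proof (cases "(t, c, w')" rule: nu_word.cases)
    case (4 a t' c' v)
    then have "node_horiz t c (East # w) (length t) = c" using "2.prems"(3)[of "length t"] by simp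
    moreover have "node_horiz t (c - 1) w (length t) \<le> c - 1" using 4 by (intro node_horiz_top) auto
    moreover have "0 < c" using "2.prems"(1) by simp
    ultimately show ?thesis by simp
  qed (use 2 in auto)
next
  case (4 a t c w)
  show ?case
  proof (cases "(a # t, c, w')" rule: nu_word.cases)
    case (2 t' c' v)
    then have w': "w' = East # v" and "0 < c" using "4.prems"(2) by simp_all
    then have "node_horiz (a # t) (c - 1) v (Suc (length t)) = c" using "4.prems"(3)[of "Suc (length t)"] by simp
    moreover have "node_horiz (a # t) (c - 1) v (length (a # t)) \<le> c - 1" by (intro node_horiz_top) auto
    ultimately show ?thesis using \<open>0 < c\<close> by simp
  next
    case (4 a' t' c' v)
    then have w': "w' = North # v" by simp
    have "node_horiz t (c + a) w j = node_horiz t (c + a) v j" if "1 \<le> j" "j \<le> length t" for j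
      using "4.prems"(3)[of j] that w' by simp
    then show ?thesis using "4.IH"[of v] "4.prems" w' by simp
  qed (use 4 in auto)
qed simp

section \<open>The order on height functions\<close>

text \<open>By \<open>forest_inv_card\<close> the truncated differences are the cardinalities, so
  this is the s-weak order in terms of heights.\<close>

definition drop_le :: "nat \<Rightarrow> (nat \<Rightarrow> nat) \<Rightarrow> (nat \<Rightarrow> nat) \<Rightarrow> bool" where
  "drop_le n h g \<longleftrightarrow>
     (\<forall>x y. 1 \<le> x \<and> x < y \<and> y \<le> n \<longrightarrow> min_on h x y - h y \<le> min_on g x y - g y)"

text \<open>The effect of a rotation on the heights; \<open>L = 0\<close> means that the block
  reaches down to the last label.\<close>

definition raise :: "nat \<Rightarrow> nat \<Rightarrow> (nat \<Rightarrow> nat) \<Rightarrow> nat \<Rightarrow> nat" where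
  "raise L K h = (\<lambda>j. if L < j \<and> j \<le> K then Suc (h j) else h j)"

lemma min_on_raise_inside:
  assumes "L < x" "x < y" "y \<le> K"
  shows "min_on (raise L K h) x y = Suc (min_on h x y)"
proof (rule antisym)
  obtain j where "x \<le> j" "j < y" "h j = min_on h x y" using min_on_attained[OF assms(2), of h] by auto
  then show "min_on (raise L K h) x y \<le> Suc (min_on h x y)"
    using min_on_le[of x j y "raise L K h"] assms by (auto simp: raise_def)
  show "Suc (min_on h x y) \<le> min_on (raise L K h) x y"
    using assms min_on_le[of x _ y h] by (subst min_on_ge_iff) (auto simp: raise_def)
qed

text \<open>For \<open>x\<close> and \<open>y\<close> both in the block, minimum and height grow by
  one together. If only \<open>y\<close> is in it, then \<open>h L \<le> d \<le> h y\<close> makes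
  the old difference 0. If \<open>y\<close> is outside, only the minimum can grow.\<close>

lemma drop_le_raise:
  assumes "\<And>j. L < j \<Longrightarrow> j \<le> K \<Longrightarrow> d \<le> h j" "1 \<le> L \<Longrightarrow> h L \<le> d"
  shows "drop_le n h (raise L K h)"
  unfolding drop_le_def
proof (intro allI impI, elim conjE)
  fix x y assume xy: "1 \<le> x" "x < y" "y \<le> n"
  show "min_on h x y - h y \<le> min_on (raise L K h) x y - raise L K h y"
  proof (cases "L < y \<and> y \<le> K")
    case True
    show ?thesis
    proof (cases "L < x")
      case True
      then show ?thesis
        using min_on_raise_inside[of L x y K h] xy \<open>L < y \<and> y \<le> K\<close> by (simp add: raise_def)
    next
      case False
      then have "min_on h x y \<le> h L" "h L \<le> d" "d \<le> h y"
        using xy True assms by (auto intro: min_on_le)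
      then show ?thesis by simp
    qed
  next
    case False
    have "min_on h x y \<le> min_on (raise L K h) x y"
      using xy by (intro min_on_leI) (auto simp: raise_def)
    moreover have "raise L K h y = h y" using False by (simp add: raise_def)
    ultimately show ?thesis by (simp add: diff_le_mono)
  qed
qed

text \<open>For \<open>y\<close> at most \<open>L\<close> nothing changes, and for \<open>y\<close>
  in the block the new difference equals the old one or is 0. The remaining case is \<open>y\<close>
  above \<open>K\<close>, where \<open>h\<close> and \<open>g\<close> agree at \<open>y\<close> and
  the minima must be compared.\<close>

lemma raise_drop_le:
  assumes le: "drop_le n h g" and pw: "\<And>j. 1 \<le> j \<Longrightarrow> j \<le> n \<Longrightarrow> h j \<le> g j"
    and K: "1 \<le> K" "h K < g K" and above: "\<And>j. K < j \<Longrightarrow> j \<le> n \<Longrightarrow> h j = g j"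
    and block: "L < K" "\<And>j. L < j \<Longrightarrow> j < K \<Longrightarrow> h K < h j" "1 \<le> L \<Longrightarrow> h L \<le> h K"
  shows "drop_le n (raise L K h) g"
  unfolding drop_le_def
proof (intro allI impI, elim conjE)
  fix x y assume xy: "1 \<le> x" "x < y" "y \<le> n"
  let ?r = "raise L K h"
  have blk: "h K \<le> h j" if "L < j" "j \<le> K" for j
    using block(2)[of j] that by (cases "j = K") auto
  have hg: "min_on h x y - h y \<le> min_on g x y - g y" using le xy unfolding drop_le_def by blast
  have rL: "?r j = h j" if "j \<le> L \<or> K < j" for j using that by (auto simp: raise_def)
  consider "y \<le> L" | "L < y" "y \<le> K" | "K < y" by linarith
  then show "min_on ?r x y - ?r y \<le> min_on g x y - g y"
  proof cases
    case 1
    then have "min_on ?r x y = min_on h x y" by (intro min_on_cong) (auto simp: rL)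
    then show ?thesis using hg rL[of y] 1 by simp
  next
    case 2
    show ?thesis
    proof (cases "L < x")
      case True
      then show ?thesis using min_on_raise_inside[of L x y K h] hg xy 2 by (simp add: raise_def)
    next
      case False
      then have "min_on ?r x y \<le> h L" "h L \<le> h K" "h K \<le> h y"
        using min_on_le[of x L y ?r] xy 2 block(3) blk rL[of L] by auto
      then show ?thesis using 2 by (simp add: raise_def)
    qed
  next
    case 3
    then have y: "?r y = g y" "h y = g y" using rL above xy by auto
    consider "K < x" | "x \<le> L" | "L < x" "x \<le> K" by linarith
    then show ?thesis
    proof cases
      case 1
      then have "min_on ?r x y = min_on h x y" by (intro min_on_cong) (auto simp: rL)
      then show ?thesis using hg y by simp
    next
      case 2
      \<comment> \<open>The interval contains \<open>L\<close>, which is not raised and is no higher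
        than the block, so raising the block does not raise the minimum.\<close>
      have "\<exists>i. x \<le> i \<and> i < y \<and> ?r i \<le> h j" if "x \<le> j" "j < y" for j
      proof (cases "L < j \<and> j \<le> K")
        case True
        then show ?thesis using 2 3 blk[of j] block(1,3) xy rL[of L] by (intro exI[of _ L]) auto
      next
        case False
        then show ?thesis using that rL[of j] by (intro exI[of _ j]) auto
      qed
      then have "min_on ?r x y \<le> min_on h x y" using xy by (intro min_on_leI)
      then show ?thesis using hg y by linarith
    next
      case x: 3
      \<comment> \<open>Here \<open>K\<close> is the witness for the block: \<open>Suc (h K)\<close>
        is at most \<open>g K\<close>, and at most \<open>h j \<le> g j\<close> for the other
        \<open>j\<close> by the strict inequality in the block.\<close>
      have "\<exists>i. x \<le> i \<and> i < y \<and> ?r i \<le> g j" if "x \<le> j" "j < y" for j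
      proof (cases "K < j")
        case True
        then show ?thesis using that above[of j] rL[of j] xy by (intro exI[of _ j]) auto
      next
        case False
        have "?r K \<le> g j"
        proof (cases "j = K")
          case True
          then show ?thesis using K by (simp add: raise_def)
        next
          case False
          then have "h K < h j" "h j \<le> g j"
            using \<open>\<not> K < j\<close> block(2)[of j] pw[of j] that x xy by simp_all
          then show ?thesis by (simp add: raise_def)
        qed
        then show ?thesis using x 3 by (intro exI[of _ K]) auto
      qed
      then have "min_on ?r x y \<le> min_on g x y" using xy by (intro min_on_leI)
      then show ?thesis using y by (simp add: diff_le_mono)
    qed
  qed
qed

text \<open>Descending induction on \<open>j\<close>. If \<open>k\<close> is the first later label
  with \<open>h k < h j\<close>, then the minimum of \<open>h\<close> from \<open>j\<close> to
  \<open>k - 1\<close> is \<open>h j\<close>. The difference \<open>h j - h k\<close> is positive,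
  so truncation is harmless and \<open>h k \<le> g k\<close> gives
  \<open>h j \<le> g j\<close>.\<close>

lemma drop_le_pointwise:
  assumes le: "drop_le n h g" and n: "h n = 0"
  shows "1 \<le> j \<Longrightarrow> j \<le> n \<Longrightarrow> h j \<le> g j"
proof (induction "n - j" arbitrary: j rule: less_induct)
  case less
  show ?case
  proof (cases "h j = 0")
    case False
    then have "j < n" "h n < h j" using n less.prems by (cases "j = n"; simp)+
    define k where "k = (LEAST k. j < k \<and> h k < h j)"
    have k: "j < k \<and> h k < h j"
      unfolding k_def by (rule LeastI[of _ n]) (use \<open>j < n\<close> \<open>h n < h j\<close> in simp)
    have kn: "k \<le> n"
      unfolding k_def by (rule Least_le) (use \<open>j < n\<close> \<open>h n < h j\<close> in simp)
    have "h j \<le> h i" if "j \<le> i" "i < k" for i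
      using not_less_Least[of i "\<lambda>k. j < k \<and> h k < h j"] that unfolding k_def by (cases "i = j") auto
    then have "h j \<le> min_on h j k" using k by (simp add: min_on_ge_iff)
    moreover have "min_on h j k - h k \<le> min_on g j k - g k"
      using le k kn less.prems unfolding drop_le_def by blast
    moreover have "min_on g j k \<le> g j" using k by (intro min_on_le) auto
    moreover have "h k \<le> g k" using less.hyps[of k] k kn less.prems by auto
    ultimately show ?thesis using k by linarith
  qed simp
qed

section \<open>Rotations\<close>

lemma count_take_mono: "p \<le> q \<Longrightarrow> count_list (take p xs) y \<le> count_list (take q xs) y"
  by (metis count_list_append le_add1 le_add_diff_inverse take_add)

lemma sum_list_take_mono: "p \<le> q \<Longrightarrow> sum_list (take p t) \<le> sum_list (take q (t :: nat list))"
  by (metis le_add1 le_add_diff_inverse sum_list_append take_add)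

lemma horiz_point:
  assumes "nu_word t 0 \<mu>" "p \<le> length \<mu>"
  shows "horiz (nu t) (point \<mu> p) =
    sum_list (take (count_list (take p \<mu>) North) t) - count_list (take p \<mu>) East"
  using assms unfolding point_def by (intro horiz_nu) (simp add: nu_word_iff)

lemma horiz_step:
  assumes "nu_word t 0 \<mu>" "p < length \<mu>"
  shows "horiz (nu t) (point \<mu> p) \<le> Suc (horiz (nu t) (point \<mu> (Suc p)))"
    and "\<mu> ! p = North \<Longrightarrow> horiz (nu t) (point \<mu> p) \<le> horiz (nu t) (point \<mu> (Suc p))"
proof -
  define a b where "a = count_list (take p \<mu>) North" "b = count_list (take p \<mu>) East"
  have "sum_list (take a t) \<le> sum_list (take (Suc a) t)" by (rule sum_list_take_mono) simp
  moreover have "take (Suc p) \<mu> = take p \<mu> @ [\<mu> ! p]" using assms(2) by (rule take_Suc_conv_app_nth)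
  ultimately show "horiz (nu t) (point \<mu> p) \<le> Suc (horiz (nu t) (point \<mu> (Suc p)))"
    "\<mu> ! p = North \<Longrightarrow> horiz (nu t) (point \<mu> p) \<le> horiz (nu t) (point \<mu> (Suc p))"
    using assms by (cases "\<mu> ! p"; auto simp: horiz_point count_list_append a_b_def)+
qed

text \<open>The distance falls by at most one per step and does not fall on the north step at
  \<open>k\<close>. So the first later point with distance at most \<open>f k\<close> has exactly
  this distance; such a point exists since the path ends at distance 0.\<close>

lemma next_same_horiz:
  assumes l: "nu_word t 0 \<mu>" and v: "valley \<mu> k"
  defines "f \<equiv> \<lambda>p. horiz (nu t) (point \<mu> p)" and "l \<equiv> next_same_horiz (nu t) \<mu> k"
  shows "k < l \<and> l \<le> length \<mu> \<and> f l = f k \<and> (\<forall>p. k < p \<and> p < l \<longrightarrow> f k < f p)"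
proof -
  have k: "k < length \<mu>" "\<mu> ! k = North" using v by (auto simp: valley_def)
  define P where "P p \<longleftrightarrow> k < p \<and> f p \<le> f k" for p
  have "f (length \<mu>) = 0" using l unfolding f_def horiz_point[OF l order_refl] by (simp add: nu_word_iff)
  then have Pn: "P (length \<mu>)" using k by (simp add: P_def)
  define m where "m = (LEAST p. P p)"
  have Pm: "P m" unfolding m_def by (rule LeastI[of P, OF Pn])
  have mn: "m \<le> length \<mu>" unfolding m_def by (rule Least_le[of P, OF Pn])
  have gt: "f k < f p" if "k < p" "p < m" for p
    using not_less_Least[of p P] that unfolding m_def P_def by auto
  obtain q where q: "m = Suc q" "k \<le> q" using Pm unfolding P_def by (cases m) auto
  have "f k \<le> f m"
  proof (cases "q = k")
    case True
    then show ?thesis using horiz_step(2)[OF l k] q by (simp add: f_def)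
  next
    case False
    then have "f k < f q" using gt q by auto
    moreover have "f q \<le> Suc (f m)" unfolding f_def q(1) using horiz_step(1)[OF l, of q] q mn by auto
    ultimately show ?thesis by simp
  qed
  then have eq: "f m = f k" using Pm by (simp add: P_def)
  have "l = m" unfolding l_def next_same_horiz_def
  proof (rule Least_equality)
    show "k < m \<and> m \<le> length \<mu> \<and> horiz (nu t) (point \<mu> m) = horiz (nu t) (point \<mu> k)"
      using Pm mn eq by (simp add: P_def f_def)
  next
    fix p assume p: "k < p \<and> p \<le> length \<mu> \<and> horiz (nu t) (point \<mu> p) = horiz (nu t) (point \<mu> k)"
    show "m \<le> p" unfolding m_def by (rule Least_le) (use p in \<open>simp add: P_def f_def\<close>)
  qed
  then show ?thesis using Pm mn eq gt by (auto simp: P_def)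
qed

text \<open>A rotation turns \<open>A @ East # B @ D\<close> into \<open>A @ B @ East # D\<close>.
  Delaying the east step raises the distance by one at the north steps of \<open>B\<close> and at no
  others.\<close>

lemma rotation_node_horiz:
  assumes l: "nu_word t 0 \<mu>" and v: "valley \<mu> k"
  defines "\<mu>' \<equiv> rotate_at (nu t) \<mu> k" and "h \<equiv> node_horiz t 0 \<mu>"
    and "K \<equiv> length t - count_list (take k \<mu>) North"
  shows "nu_word t 0 \<mu>' \<and> 1 \<le> K \<and> K \<le> length t \<and>
    (\<exists>L<K. (\<forall>j. L < j \<and> j < K \<longrightarrow> h K < h j) \<and> (1 \<le> L \<longrightarrow> h L \<le> h K) \<and> node_horiz t 0 \<mu>' = raise L K h)"
proof -
  have k: "0 < k" "k < length \<mu>" "\<mu> ! (k - 1) = East" "\<mu> ! k = North" using v by (auto simp: valley_def)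
  define f where "f p = horiz (nu t) (point \<mu> p)" for p
  define m where "m = next_same_horiz (nu t) \<mu> k"
  have m: "k < m" "m \<le> length \<mu>" "f m = f k" "\<And>p. k < p \<Longrightarrow> p < m \<Longrightarrow> f k < f p"
    using next_same_horiz[OF l v] by (auto simp: f_def m_def)
  define A B D where ABD: "A = take (k - 1) \<mu>" "B = drop k (take m \<mu>)" "D = drop m \<mu>"
  have takek: "take k \<mu> = A @ [East]"
    using take_Suc_conv_app_nth[of "k - 1" \<mu>] k by (simp add: ABD)
  have "take m \<mu> = take k (take m \<mu>) @ B"
    unfolding ABD by (rule append_take_drop_id[symmetric])
  also have "take k (take m \<mu>) = take k \<mu>" using m(1) by (simp add: min_def)
  finally have takem: "take m \<mu> = A @ East # B" unfolding takek by simp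
  have "take m \<mu> @ D = \<mu>" unfolding ABD by (rule append_take_drop_id)
  then have "A @ East # B @ D = \<mu>" unfolding takem by simp
  then have mu: "\<mu> = A @ East # B @ D" by (rule sym)
  have mu': "\<mu>' = A @ B @ East # D"
    by (simp add: \<mu>'_def rotate_at_def Let_def ABD m_def)
  obtain B' where B: "B = North # B'"
  proof -
    have "B ! 0 = North" "B \<noteq> []" using k m by (auto simp: ABD)
    then show ?thesis using that by (cases B) auto
  qed
  \<comment> \<open>These are the rows left and the distance after \<open>A\<close>; the east step
    then lowers the distance to \<open>d\<close>, which is the height at \<open>K\<close>.\<close>
  define t1 where "t1 = drop (count_list A North) t"
  define c1 where "c1 = sum_list (take (count_list A North) t) - count_list A East"
  have lA: "nu_word t1 c1 (East # B @ D)"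
    using nu_word_append[of t 0 A "East # B @ D"] l mu by (simp add: t1_def c1_def)
  then obtain d where d: "c1 = Suc d" by (cases c1) auto
  with lA have lB: "nu_word t1 d (B @ D)" by simp
  have lB': "nu_word t1 (Suc d) (B @ East # D)" using nu_word_delay_East[OF lB] .
  have l': "nu_word t 0 \<mu>'"
    using nu_word_replace[of t 0 A "East # B @ D" "B @ East # D"] l lB' d
    unfolding mu' mu[symmetric] t1_def c1_def by simp
  have K: "K = length t1" by (simp add: K_def takek count_list_append t1_def)
  have t1: "t1 \<noteq> []" using lB B by (cases t1) auto
  \<comment> \<open>As many rows are left after \<open>B\<close>, so the labels visited in
    \<open>B\<close> are \<open>L + 1\<close>, ..., \<open>K\<close>.\<close>
  define L where "L = length t1 - count_list B North"
  have cB: "count_list B North \<le> length t1" "count_list B East \<le> d + sum_list (take (count_list B North) t1)"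
    using nu_word_count[OF lB] by auto
  have LK: "L < K" using t1 B by (simp add: L_def K)
  have KT: "K + count_list A North = length t" using nu_word_count(1)[of t 0 A] l mu by (auto simp: K t1_def)
  have ln: "L + count_list B North = length t1" using cB by (simp add: L_def)
  define t2 where "t2 = drop (count_list B North) t1"
  define d2 where "d2 = d + sum_list (take (count_list B North) t1) - count_list B East"
  have hA: "h j =
      (if j \<le> K then if j \<le> L then node_horiz t2 d2 D j else node_horiz t1 d B j else node_horiz t 0 A j)" for j
    using node_horiz_append[of t 0 A "East # B @ D" j] node_horiz_append[OF lB, of j] l mu KT ln d
    by (auto simp: h_def K t1_def[symmetric] c1_def[symmetric] t2_def[symmetric] d2_def[symmetric])
  \<comment> \<open>The rotated path leaves \<open>B\<close> one unit higher, and the delayed east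
    step takes this back, so both paths enter \<open>D\<close> in the same state.\<close>
  have "Suc d + sum_list (take (count_list B North) t1) - count_list B East = Suc d2"
    using cB by (simp add: d2_def)
  then have hA': "node_horiz t 0 \<mu>' j =
      (if j \<le> K then if j \<le> L then node_horiz t2 d2 D j else node_horiz t1 (Suc d) B j else node_horiz t 0 A j)" for j
    using node_horiz_append[of t 0 A "B @ East # D" j] node_horiz_append[OF lB', of j] l' mu' KT ln d
    by (auto simp: K t1_def[symmetric] c1_def[symmetric] t2_def[symmetric])
  have raise: "node_horiz t 0 \<mu>' = raise L K h"
  proof
    fix j show "node_horiz t 0 \<mu>' j = raise L K h j"
      using node_horiz_Suc[OF lB, of j] ln unfolding hA' raise_def hA by (auto simp: K)
  qed
  have hK: "h K = d" using LK t1 B unfolding hA K by (cases t1) auto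
  have fk: "f k = d"
    using k l d by (simp add: f_def horiz_point takek count_list_append c1_def)
  have "f m = d2"
  proof -
    have "sum_list (take (count_list A North + count_list B North) t) =
        sum_list (take (count_list A North) t) + sum_list (take (count_list B North) t1)"
      by (simp add: take_add t1_def)
    then show ?thesis
      using m(2) l d unfolding f_def horiz_point[OF l m(2)] takem
      by (simp add: count_list_append c1_def d2_def)
  qed
  then have d2: "d2 = d" using fk m by simp
  have "h L \<le> h K" if "1 \<le> L"
  proof -
    have len: "length t2 = L" by (simp add: t2_def L_def)
    then have "node_horiz t2 d2 D (length t2) \<le> d2" using that by (intro node_horiz_top) auto
    then show ?thesis using LK unfolding hK by (simp add: hA len d2)
  qed
  \<comment> \<open>Counting north steps places the one labelled \<open>j\<close> strictly between
    the positions \<open>k\<close> and \<open>m\<close>, where the distance exceeds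
    \<open>f k\<close>.\<close>
  moreover have "h K < h j" if j: "L < j" "j < K" for j
  proof -
    have "1 \<le> j" "j \<le> length t" using j KT by auto
    from nu_word_split[OF l this, unfolded add_0, folded h_def] obtain A' C
      where C: "\<mu> = A' @ North # C" "count_list A' North = length t - j"
      "h j = sum_list (take (length t - j) t) - count_list A' East" by blast
    define p where "p = length A'"
    have p: "p < length \<mu>" "take p \<mu> = A'" "take (Suc p) \<mu> = A' @ [North]" by (simp_all add: p_def C(1))
    have fp: "f p = h j" using horiz_point[OF l, of p] p(1) C(2,3) by (simp add: f_def p(2))
    have cm: "count_list (take m \<mu>) North = length t - L"
      using KT ln by (simp add: takem count_list_append K)
    have ck: "count_list (take k \<mu>) North = length t - K"
      using KT by (simp add: takek count_list_append)
    have "k < p"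
    proof (rule ccontr)
      assume "\<not> k < p"
      then consider "p = k" | "Suc p \<le> k" by linarith
      then show False
      proof cases
        case 1
        then show False using C(2) ck p(2) j KT by auto
      next
        case 2
        then have "count_list (take (Suc p) \<mu>) North \<le> length t - K"
          unfolding ck[symmetric] by (rule count_take_mono)
        then show False using C(2) p(3) j KT by (auto simp: count_list_append)
      qed
    qed
    moreover have "p < m"
    proof (rule ccontr)
      assume "\<not> p < m"
      then have "length t - L \<le> count_list (take p \<mu>) North"
        unfolding cm[symmetric] by (intro count_take_mono) simp
      then show False using C(2) p(2) j KT by simp
    qed
    ultimately show ?thesis using m(4)[of p] fp fk hK by simp
  qed
  ultimately show ?thesis using l' LK KT raise by (auto intro!: exI[of _ L])
qed

section \<open>Rotations generate the order on heights\<close>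

lemma nu_rotation_drop_le:
  assumes "nu_rotation (nu t) \<mu> \<mu>'"
  shows "drop_le (length t) (node_horiz t 0 \<mu>) (node_horiz t 0 \<mu>')"
proof -
  from assms obtain k where l: "nu_word t 0 \<mu>" "valley \<mu> k" "\<mu>' = rotate_at (nu t) \<mu> k"
    by (auto simp: nu_rotation_def nu_paths_eq)
  define K where "K = length t - count_list (take k \<mu>) North"
  from rotation_node_horiz[OF l(1,2)] obtain L where
    L: "L < K" "\<And>j. L < j \<Longrightarrow> j < K \<Longrightarrow> node_horiz t 0 \<mu> K < node_horiz t 0 \<mu> j"
      "1 \<le> L \<longrightarrow> node_horiz t 0 \<mu> L \<le> node_horiz t 0 \<mu> K"
      "node_horiz t 0 \<mu>' = raise L K (node_horiz t 0 \<mu>)"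
    unfolding K_def l(3) by blast
  show ?thesis unfolding L(4)
  proof (rule drop_le_raise[where d = "node_horiz t 0 \<mu> K"])
    show "node_horiz t 0 \<mu> K \<le> node_horiz t 0 \<mu> j" if "L < j" "j \<le> K" for j
      using L(2)[of j] that by (cases "j = K") auto
  qed (use L(3) in simp)
qed

lemma nu_Tamari_le_drop_le:
  "nu_Tamari_le (nu t) \<mu> \<mu>' \<Longrightarrow> drop_le (length t) (node_horiz t 0 \<mu>) (node_horiz t 0 \<mu>')"
  unfolding nu_Tamari_le_def
proof (induction rule: rtranclp_induct)
  case base
  show ?case by (simp add: drop_le_def)
next
  case (step \<mu>1 \<mu>2)
  from nu_rotation_drop_le[OF step.hyps(2)] step.IH show ?case unfolding drop_le_def by (meson le_trans)
qed

text \<open>The rotation is at the valley before the north step labelled \<open>K\<close>, the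
  largest label at which the heights differ.\<close>

lemma drop_le_rotation_exists:
  assumes l: "nu_word t 0 \<mu>" "nu_word t 0 \<mu>'"
    and le: "drop_le (length t) (node_horiz t 0 \<mu>) (node_horiz t 0 \<mu>')" and ne: "\<mu> \<noteq> \<mu>'"
  obtains L K \<mu>'' where "nu_rotation (nu t) \<mu> \<mu>''" "node_horiz t 0 \<mu>'' = raise L K (node_horiz t 0 \<mu>)"
    "L < K" "K \<le> length t" "drop_le (length t) (node_horiz t 0 \<mu>'') (node_horiz t 0 \<mu>')"
proof -
  define h g n where hg: "h = node_horiz t 0 \<mu>" "g = node_horiz t 0 \<mu>'" "n = length t"
  have "t \<noteq> []" using node_horiz_inj[OF l] ne by (cases t) auto
  then have top: "h n = 0" "g n = 0" unfolding hg by (metis node_horiz_top le_zero_eq)+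
  have pw: "h j \<le> g j" if "1 \<le> j" "j \<le> n" for j
    using drop_le_pointwise[OF le _ that[unfolded hg]] top by (simp add: hg)
  define S where "S = {j. 1 \<le> j \<and> j \<le> n \<and> h j \<noteq> g j}"
  have fin: "finite S" by (rule finite_subset[of _ "{..n}"]) (auto simp: S_def)
  have "S \<noteq> {}" using node_horiz_inj[OF l] ne by (auto simp: S_def hg)
  define K where "K = Max S"
  have KS: "K \<in> S" unfolding K_def using fin \<open>S \<noteq> {}\<close> by (rule Max_in)
  then have K: "1 \<le> K" "K < n" "h K < g K"
    using top pw[of K] by (cases "K = n"; auto simp: S_def)+
  have above: "h j = g j" if "K < j" "j \<le> n" for j
    using Max_ge[OF fin, of j] that K unfolding K_def[symmetric] by (auto simp: S_def)
  have "K \<le> length t" using K(2) by (simp add: hg)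
  from nu_word_split[OF l(1) K(1) this, folded hg] obtain A B
    where A: "\<mu> = A @ North # B" "count_list A North = n - K" by blast
  then obtain A' e where A': "A = A' @ [e]" using K by (cases A rule: rev_cases) auto
  \<comment> \<open>After a north step, \<open>h K\<close> would be the largest height possible over
    \<open>h (Suc K) = g (Suc K)\<close>, contradicting \<open>h K < g K\<close>.\<close>
  have "e = East"
  proof (rule ccontr)
    assume "e \<noteq> East"
    then have e: "e = North" by (cases e) auto
    have c: "Suc (K + count_list A' North) = length t" using A(2) A' e K by (simp add: count_list_append hg)
    have "h K = h (Suc K) + t ! count_list A' North"
      using node_horiz_North_North[of t 0 A' B K] l(1) A(1) A' e c by (simp add: hg)
    moreover have "g K \<le> g (Suc K) + t ! (length t - Suc K)"
      using node_horiz_step[OF l(2) K(1)] K(2) by (simp add: hg)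
    moreover have "length t - Suc K = count_list A' North" using c by simp
    ultimately show False using above[of "Suc K"] K by simp
  qed
  define k where "k = length A"
  have v: "valley \<mu> k" by (simp add: valley_def k_def A(1) A' \<open>e = East\<close> nth_append)
  have KK: "length t - count_list (take k \<mu>) North = K" using A K by (simp add: k_def hg)
  define \<mu>'' where "\<mu>'' = rotate_at (nu t) \<mu> k"
  from rotation_node_horiz[OF l(1) v] obtain L where l'': "nu_word t 0 \<mu>''" and
    L: "L < K" "\<And>j. L < j \<Longrightarrow> j < K \<Longrightarrow> h K < h j" "1 \<le> L \<Longrightarrow> h L \<le> h K" "node_horiz t 0 \<mu>'' = raise L K h"
    unfolding KK \<mu>''_def hg by blast
  have "drop_le n (raise L K h) g"
    by (rule raise_drop_le) (use le pw K above L in \<open>auto simp: hg\<close>)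
  moreover have "nu_rotation (nu t) \<mu> \<mu>''"
    unfolding nu_rotation_def nu_paths_eq using l(1) l'' v \<mu>''_def by auto
  ultimately show ?thesis using that[of \<mu>'' L K] L(1,4) K(2) by (simp add: hg)
qed

text \<open>Each rotation that stays below \<open>\<mu>'\<close> reduces the total gap between the
  heights, as it closes the gap at \<open>K\<close> by one.\<close>

lemma drop_le_nu_Tamari_le:
  "nu_word t 0 \<mu> \<Longrightarrow> nu_word t 0 \<mu>' \<Longrightarrow> drop_le (length t) (node_horiz t 0 \<mu>) (node_horiz t 0 \<mu>') \<Longrightarrow>
     nu_Tamari_le (nu t) \<mu> \<mu>'"
proof (induction "\<Sum>j=1..length t. node_horiz t 0 \<mu>' j - node_horiz t 0 \<mu> j" arbitrary: \<mu> rule: less_induct)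
  case less
  show ?case
  proof (cases "\<mu> = \<mu>'")
    case True
    then show ?thesis by (simp add: nu_Tamari_le_def)
  next
    case False
    from drop_le_rotation_exists[OF less.prems False] obtain L K \<mu>'' where
      rot: "nu_rotation (nu t) \<mu> \<mu>''" and r: "node_horiz t 0 \<mu>'' = raise L K (node_horiz t 0 \<mu>)"
      and LK: "L < K" "K \<le> length t" and le: "drop_le (length t) (node_horiz t 0 \<mu>'') (node_horiz t 0 \<mu>')" .
    have l'': "nu_word t 0 \<mu>''" using rot by (simp add: nu_rotation_def nu_paths_eq)
    have "t \<noteq> []" using LK by auto
    then have "node_horiz t 0 \<mu>'' (length t) = 0" using node_horiz_top[of t 0 \<mu>''] by simp
    \<comment> \<open>As subtraction is truncated, the strict decrease at \<open>K\<close> needs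
      that the raised height there does not exceed that of \<open>\<mu>'\<close>.\<close>
    then have pw: "node_horiz t 0 \<mu>'' j \<le> node_horiz t 0 \<mu>' j" if "1 \<le> j" "j \<le> length t" for j
      using drop_le_pointwise[OF le] that by blast
    have "(\<Sum>j=1..length t. node_horiz t 0 \<mu>' j - node_horiz t 0 \<mu>'' j) <
        (\<Sum>j=1..length t. node_horiz t 0 \<mu>' j - node_horiz t 0 \<mu> j)"
    proof (rule sum_strict_mono_ex1)
      show "\<forall>j\<in>{1..length t}. node_horiz t 0 \<mu>' j - node_horiz t 0 \<mu>'' j \<le> node_horiz t 0 \<mu>' j - node_horiz t 0 \<mu> j"
        by (auto simp: r raise_def)
      have "node_horiz t 0 \<mu>' K - node_horiz t 0 \<mu>'' K < node_horiz t 0 \<mu>' K - node_horiz t 0 \<mu> K"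
        using pw[of K] LK unfolding r by (simp add: raise_def)
      then show "\<exists>j\<in>{1..length t}. node_horiz t 0 \<mu>' j - node_horiz t 0 \<mu>'' j < node_horiz t 0 \<mu>' j - node_horiz t 0 \<mu> j"
        using LK by (intro bexI[of _ K]) auto
    qed simp
    then have "nu_Tamari_le (nu t) \<mu>'' \<mu>'" using less.hyps l'' less.prems(2) le by blast
    then show ?thesis using rot unfolding nu_Tamari_le_def by (rule converse_rtranclp_into_rtranclp[rotated])
  qed
qed

theorem theorem2p32:
  fixes s :: "nat list"
  shows "order_iso_betw phi
           (s_Tamari_trees s) (s_weak_le s)
           (nu_paths (nu (rev s))) (nu_Tamari_le (nu (rev s)))"
  unfolding order_iso_betw_def
proof (intro conjI ballI)
  have F: "forest (rev s) [T] (phi T)" if "T \<in> s_Tamari_trees s" for T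
    using that forest_phi by (auto simp: s_Tamari_trees_eq)
  have nu_word: "nu_word (rev s) 0 (phi T)" if "T \<in> s_Tamari_trees s" for T
    using forest_nu_word[OF F[OF that]] by simp
  show "bij_betw phi (s_Tamari_trees s) (nu_paths (nu (rev s)))"
    unfolding bij_betw_def
  proof (intro conjI equalityI subsetI inj_onI)
    fix R T assume "R \<in> s_Tamari_trees s" "T \<in> s_Tamari_trees s" "phi R = phi T"
    then have "[R] = [T]" using F forest_unique by metis
    then show "R = T" by simp
  next
    fix \<mu> assume "\<mu> \<in> nu_paths (nu (rev s))"
    then have "nu_word (rev s) 0 \<mu>" by (simp add: nu_paths_eq)
    \<comment> \<open>A word parsed from distance 0 yields a forest with exactly one tree.\<close>
    from forest_exists[OF this] obtain T where "forest (rev s) [T] \<mu>" by (auto simp: length_Suc_conv)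
    then show "\<mu> \<in> phi ` s_Tamari_trees s" using forest_phi by (auto simp: s_Tamari_trees_eq)
  qed (use nu_word in \<open>auto simp: nu_paths_eq\<close>)
  fix R T assume RT: "R \<in> s_Tamari_trees s" "T \<in> s_Tamari_trees s"
  have "s_weak_le s R T \<longleftrightarrow>
      drop_le (length (rev s)) (node_horiz (rev s) 0 (phi R)) (node_horiz (rev s) 0 (phi T))"
    using forest_inv_card[OF F[OF RT(1)]] forest_inv_card[OF F[OF RT(2)]]
    by (auto simp: s_weak_le_def drop_le_def)
  also have "\<dots> \<longleftrightarrow> nu_Tamari_le (nu (rev s)) (phi R) (phi T)"
    using nu_Tamari_le_drop_le drop_le_nu_Tamari_le nu_word RT by blast
  finally show "s_weak_le s R T \<longleftrightarrow> nu_Tamari_le (nu (rev s)) (phi R) (phi T)" .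
qed

end
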